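(* Let $X$ be a Hilbert space with norm $\|\cdot\|$ and let $\mathcal J:X\to[0,\infty]$ be convex, lower semicontinuous, positively homogeneous of degree 1 (i.e. $\mathcal J(\lambda u)=\lambda\mathcal J(u)$ for all $\lambda>0$, $u\in X$), with dense domain $\{u\in X:\mathcal J(u)<\infty\}$. If $u:[0,\infty)\to X$ is an energetic solution for the energetic rate-independent system $(X,\mathcal E,\|\cdot\|)$ with $\mathcal E(t,u)=t\,\mathcal J(u)$, then the reparametrized function $w:[0,\infty)\to X$ associated with $u$ (defined in the context) is a solution for the gradient system $(X,\mathcal J,\frac12\|\cdot\|^2)$, i.e. it satisfies $0\in Ew'(s)+\partial\mathcal J(w(s))$ for a.a. $s>0$ and $w(0)=u(0)$.
   Context: $E:X\to X^*$ is the Riesz isomorphism and $\partial\mathcal J(u)\subset X^*$ is the convex subdifferential. Convention: $0\cdot\infty=0$. Variation: $\mathrm{Var}_{\|\cdot\|}(u;[r,t])=\sup\{\sum_{j=1}^N\|u(t_j)-u(t_{j-1})\| : N\in\mathbb N,\ r\le t_0<t_1<\dots<t_N\le t\}$. Energetic solution: $u:[0,\infty)\to X$ is an energetic solution for $(X,\mathcal E,\|\cdot\|)$ with $\mathcal E(t,u)=t\mathcal J(u)$ if $t\mapsto\mathcal J(u(t))$ lies in $L^1_{\mathrm{loc}}([0,\infty))$ (in particular it is integrable near $0$) and if for all $r,t\ge0$ with $r<t$ in (E) and all $t\ge0$ in (S): (S) for all $\tilde u\in X$: $t\mathcal J(u(t))\le t\mathcal J(\tilde u)+\|\tilde u-u(t)\|$;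 (E) $t\mathcal J(u(t))+\mathrm{Var}_{\|\cdot\|}(u;[r,t])=r\mathcal J(u(r))+\int_r^t\mathcal J(u(\tau))\,d\tau$; (I) $u(0)=u(0^+):=\lim_{\tau\to0^+}u(\tau)$ in the norm topology. Energetic solutions have finite variation on bounded intervals, so the one-sided limits $u(t^\pm)$ exist for all $t$. Affine interpolation: for a function $g$ on $[0,\infty)$ with one-sided limits $g(t^\pm)$ (and $g(0^-):=g(0)$), put $g_\theta(t)=(1-\theta)g(t^-)+\theta g(t^+)$ for $\theta\in[0,1]$, $t\ge0$. Reparametrized function $w$: set $$\hat s(t)=\int_0^t\tau\,\|du(\tau)\|:=\sup\Big\{\sum_{j=1}^N t_{j-1}\|u(t_j)-u(t_{j-1})\| : N\in\mathbb N,\ 0\le t_0<t_1<\dots<t_N\le t\Big\},\qquad \hat t(s)=\inf\{t\ge0:\hat s(t)\ge s\},$$ and define $$w(s)=u_\theta(\hat t(s))\quad\text{for } s=\hat s_\theta(\hat t(s)),$$ i.e. $\theta\in[0,1]$ is chosen such that $s=\hat s_\theta(\hat t(s))$. A solution $w$ of the gradient system is continuous on $[0,\infty)$ and lies in $H^1_{\mathrm{loc}}((0,\infty);X)$, so that $w'(s)$ exists for a.a. $s>0$. *)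

theory Defs
  imports "HOL-Analysis.Analysis"
begin

section \<open>Functionals on a Hilbert space\<close>

text \<open>Functionals with values in \<open>[0,\<infinity>]\<close> are \<^typ>\<open>ennreal\<close>-valued; there \<open>0 * \<infinity> = 0\<close>.\<close>

definition convex_functional :: "('a::real_vector \<Rightarrow> ennreal) \<Rightarrow> bool" where
  "convex_functional J \<longleftrightarrow>
     (\<forall>x y. \<forall>c\<in>{0..1}. J ((1 - c) *\<^sub>R x + c *\<^sub>R y) \<le> ennreal (1 - c) * J x + ennreal c * J y)"

definition lower_semicontinuous :: "('a::topological_space \<Rightarrow> ennreal) \<Rightarrow> bool" where
  "lower_semicontinuous J \<longleftrightarrow> (\<forall>x. J x \<le> Liminf (at x) J)"

definition positively_homogeneous :: "('a::real_vector \<Rightarrow> ennreal) \<Rightarrow> bool" where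
  "positively_homogeneous J \<longleftrightarrow> (\<forall>c>0. \<forall>x. J (c *\<^sub>R x) = ennreal c * J x)"

definition effective_domain :: "('a \<Rightarrow> ennreal) \<Rightarrow> 'a set" where
  "effective_domain J = {x. J x < \<infinity>}"

definition subdifferential ::
    "('a::real_normed_vector \<Rightarrow> ennreal) \<Rightarrow> 'a \<Rightarrow> ('a \<Rightarrow>\<^sub>L real) set" where
  "subdifferential J x =
     {\<xi>. x \<in> effective_domain J \<and>
         (\<forall>v. enn2ereal (J x) + ereal (blinfun_apply \<xi> (v - x)) \<le> enn2ereal (J v))}"

abbreviation riesz :: "'a::real_inner \<Rightarrow> ('a \<Rightarrow>\<^sub>L real)" where
  "riesz \<equiv> blinfun_inner_right"

section \<open>Variation and energetic solutions\<close>

text \<open>Functions on \<open>[0,\<infinity>)\<close> are total functions on \<^typ>\<open>real\<close> whose values at negative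
  arguments are irrelevant. A partition is a pair of \<open>N\<close> and the points \<open>\<tau> 0 < \<dots> < \<tau> N\<close>;
  \<open>N = 0\<close> is allowed and contributes the empty sum, so that both suprema below vanish on
  degenerate intervals.\<close>

definition partitions :: "real \<Rightarrow> real \<Rightarrow> (nat \<times> (nat \<Rightarrow> real)) set" where
  "partitions r t = {(N, \<tau>). strict_mono_on {..N} \<tau> \<and> r \<le> \<tau> 0 \<and> \<tau> N \<le> t}"

definition variation :: "(real \<Rightarrow> 'a::real_normed_vector) \<Rightarrow> real \<Rightarrow> real \<Rightarrow> ennreal" where
  "variation u r t =
     (SUP (N, \<tau>) \<in> partitions r t. ennreal (\<Sum>j<N. norm (u (\<tau> (Suc j)) - u (\<tau> j))))"

definition stable_at :: "('a::real_normed_vector \<Rightarrow> ennreal) \<Rightarrow> real \<Rightarrow> 'a \<Rightarrow> bool" where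
  "stable_at J t x \<longleftrightarrow> (\<forall>v. ennreal t * J x \<le> ennreal t * J v + ennreal (norm (v - x)))"

definition energetic_solution ::
    "('a::real_normed_vector \<Rightarrow> ennreal) \<Rightarrow> (real \<Rightarrow> 'a) \<Rightarrow> bool" where
  "energetic_solution J u \<longleftrightarrow>
     (\<lambda>t. J (u t)) \<in> borel_measurable (lebesgue_on {0..}) \<and>
     (\<forall>T\<ge>0. (\<integral>\<^sup>+\<tau>\<in>{0..T}. J (u \<tau>) \<partial>lebesgue) < \<infinity>) \<and>
     (\<forall>t\<ge>0. stable_at J t (u t)) \<and>
     (\<forall>r\<ge>0. \<forall>t>r. ennreal t * J (u t) + variation u r t
                    = ennreal r * J (u r) + (\<integral>\<^sup>+\<tau>\<in>{r..t}. J (u \<tau>) \<partial>lebesgue)) \<and>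
     (u \<longlongrightarrow> u 0) (at_right 0)"

section \<open>The reparametrized function\<close>

definition left_limit :: "(real \<Rightarrow> 'b::real_normed_vector) \<Rightarrow> real \<Rightarrow> 'b" where
  "left_limit g t = (if t = 0 then g 0 else Lim (at_left t) g)"

definition right_limit :: "(real \<Rightarrow> 'b::real_normed_vector) \<Rightarrow> real \<Rightarrow> 'b" where
  "right_limit g t = Lim (at_right t) g"

definition interpolate :: "(real \<Rightarrow> 'b::real_normed_vector) \<Rightarrow> real \<Rightarrow> real \<Rightarrow> 'b" where
  "interpolate g \<theta> t = (1 - \<theta>) *\<^sub>R left_limit g t + \<theta> *\<^sub>R right_limit g t"

text \<open>The supremum is bounded by \<open>t * variation u 0 t\<close>, which is finite for an energetic
  solution, so that the conversion to \<^typ>\<open>real\<close> loses nothing there.\<close>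

definition s_hat :: "(real \<Rightarrow> 'a::real_normed_vector) \<Rightarrow> real \<Rightarrow> real" where
  "s_hat u t = enn2real
     (SUP (N, \<tau>) \<in> partitions 0 t. ennreal (\<Sum>j<N. \<tau> j * norm (u (\<tau> (Suc j)) - u (\<tau> j))))"

definition t_hat :: "(real \<Rightarrow> 'a::real_normed_vector) \<Rightarrow> real \<Rightarrow> ereal" where
  "t_hat u s = Inf (ereal ` {t. 0 \<le> t \<and> s \<le> s_hat u t})"

text \<open>The parameter \<open>\<theta>\<close> need not be unique, but the value \<open>u\<^sub>\<theta>(t)\<close> is; hence the
  definite description ranges over the value. If \<open>\<integral> \<tau> \<parallel>du(\<tau>)\<parallel>\<close> over \<open>[0,\<infinity>)\<close> is finite
  (e.g. if \<open>u\<close> is eventually constant), then \<open>t_hat u s = \<infinity>\<close> for all large \<open>s\<close>; for these,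
  \<open>w(s)\<close> is \<open>u(\<infinity>)\<close>, the limit of \<open>u\<close> at infinity.\<close>

definition reparametrized :: "(real \<Rightarrow> 'a::real_normed_vector) \<Rightarrow> real \<Rightarrow> 'a" where
  "reparametrized u s =
     (if t_hat u s = \<infinity> then Lim at_top u
      else let t = real_of_ereal (t_hat u s)
           in THE x. \<exists>\<theta>\<in>{0..1}. s = interpolate (s_hat u) \<theta> t \<and> x = interpolate u \<theta> t)"

section \<open>Solutions of the gradient system\<close>

text \<open>The library's Bochner integral requires a second countable (separable) codomain. Strong
  (Bochner) measurability is therefore stated directly, and the identity between \<open>X\<close>-valued
  integrals that defines the weak derivative is tested with the functionals \<open>\<langle>\<cdot>, x\<rangle>\<close>, which
  commute with the Bochner integral and separate points.\<close>

definition strongly_measurable :: "'b measure \<Rightarrow> ('b \<Rightarrow> 'a::topological_space) \<Rightarrow> bool" where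
  "strongly_measurable M f \<longleftrightarrow>
     (\<exists>F. (\<forall>n::nat. simple_function M (F n)) \<and> (AE x in M. (\<lambda>n. F n x) \<longlonglongrightarrow> f x))"

definition L2_loc :: "(real \<Rightarrow> 'a::real_normed_vector) \<Rightarrow> bool" where
  "L2_loc f \<longleftrightarrow>
     strongly_measurable (lebesgue_on {0<..}) f \<and>
     (\<forall>a b. 0 < a \<and> a < b \<longrightarrow> (\<integral>\<^sup>+s\<in>{a..b}. ennreal ((norm (f s))\<^sup>2) \<partial>lebesgue) < \<infinity>)"

text \<open>\<open>C\<^sub>c\<^sup>\<infinity>((0,\<infinity>))\<close>, extended by zero:\<close>

definition test_function :: "(real \<Rightarrow> real) \<Rightarrow> bool" where
  "test_function \<phi> \<longleftrightarrow>
     (\<forall>n x. ((deriv ^^ n) \<phi>) differentiable (at x)) \<and>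
     (\<exists>a>0. \<exists>b. \<forall>s. s \<notin> {a..b} \<longrightarrow> \<phi> s = 0)"

definition weak_derivative :: "(real \<Rightarrow> 'a::real_inner) \<Rightarrow> (real \<Rightarrow> 'a) \<Rightarrow> bool" where
  "weak_derivative w g \<longleftrightarrow>
     (\<forall>\<phi> x. test_function \<phi> \<longrightarrow>
        (LINT s:{0<..}|lebesgue. deriv \<phi> s * inner (w s) x)
          = - (LINT s:{0<..}|lebesgue. \<phi> s * inner (g s) x))"

definition H1_loc :: "(real \<Rightarrow> 'a::real_inner) \<Rightarrow> bool" where
  "H1_loc w \<longleftrightarrow> L2_loc w \<and> (\<exists>g. L2_loc g \<and> weak_derivative w g)"

definition gradient_solution ::
    "('a::real_inner \<Rightarrow> ennreal) \<Rightarrow> (real \<Rightarrow> 'a) \<Rightarrow> bool" where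
  "gradient_solution J w \<longleftrightarrow>
     continuous_on {0..} w \<and> H1_loc w \<and>
     (AE s in lebesgue_on {0<..}. w differentiable (at s) \<and>
        0 \<in> riesz (vector_derivative w (at s)) +o subdifferential J (w s))"

end

theory Submission
  imports Defs
begin

text \<open>
  Write \<open>F\<close> for \<open>J\<close> on its domain, \<open>S\<close> for \<open>s\<close>-hat and \<open>W\<close> for the reparametrized function.

  The energy balance and the stability of an energetic solution together determine how the energy,
  the variation and \<open>S\<close> are related: for \<open>0 < r < t\<close>
  \<open>r (F(u(r)) - F(u(t))) \<le> Var(u;[r,t]) \<le> t (F(u(r)) - F(u(t)))\<close> and
  \<open>r Var(u;[r,t]) \<le> S(t) - S(r) \<le> t Var(u;[r,t])\<close>,
  that is, \<open>t dF = -\<parallel>du\<parallel>\<close> and \<open>dS = t \<parallel>du\<parallel>\<close>. Hence, between two times, the distance travelled is at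
  most \<open>dS / t\<close> and the energy drops by at least \<open>dS / t\<^sup>2\<close> (\<open>step_u\<close>). Both estimates survive passing to
  one-sided limits, and at a jump stability forces the energy to be affine on the segment from
  \<open>u(t-)\<close> to \<open>u(t+)\<close>, so that they hold along the segment as well (\<open>interpolate_along_jump\<close>).

  In terms of the parameter \<open>s = S\<close> this says that \<open>W\<close>, with the nonincreasing function
  \<open>\<rho>(s) = 1 / t(s)\<close>, where \<open>t(s)\<close> is the \<open>t\<close>-hat of \<open>s\<close> and \<open>1 / \<infinity> = 0\<close>, has speed at most \<open>\<rho>\<close>, that the
  energy drops at rate at least \<open>\<rho>\<^sup>2\<close>, and that the slope of the energy at \<open>W(s)\<close>, by stability, is at
  most \<open>\<rho>(s)\<close>. These three properties (locale \<open>maximal_slope_curve\<close>) already make \<open>W\<close> a gradient flow. Indeed, two difference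
  quotients of \<open>W\<close> with the same left end point \<open>s\<close> have norm at most \<open>\<rho>(s)\<close>, whereas by convexity and
  the slope bound their mean has norm almost \<open>\<rho>(s)\<close>; the parallelogram identity then makes them almost
  equal (\<open>quotients_close\<close>). So \<open>W\<close> is differentiable at every continuity point of \<open>\<rho>\<close>, hence outside a
  countable set. Comparing the slope bound with the drop of the energy in a direction slightly
  turned from the flow towards an arbitrary point shows that minus the derivative is a subgradient
  (\<open>subgradient_at_continuity_point\<close>).

  Finally, a locally Lipschitz curve that is differentiable outside a countable set is weakly
  differentiable (\<open>H1_loc_locally_Lipschitz\<close>), by shifting difference quotients onto the test
  function. The time near \<open>0\<close>, where \<open>\<rho>\<close> may be unbounded, enters only through the continuity of \<open>W\<close>
  at \<open>0\<close>, which is inherited from \<open>u(0+) = u(0)\<close>.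
\<close>

section \<open>Locally Lipschitz curves and weak derivatives\<close>

lemma tendsto_dyadic_floor: "(\<lambda>n. of_int \<lfloor>2 ^ n * s\<rfloor> / 2 ^ n) \<longlonglongrightarrow> (s::real)"
proof (rule tendsto_sandwich)
  show "(\<lambda>n. s - (1/2) ^ n) \<longlonglongrightarrow> s"
    using tendsto_diff[OF tendsto_const LIMSEQ_realpow_zero[of "1/2::real"], of s] by simp
  show "\<forall>\<^sub>F n in sequentially. s - (1/2) ^ n \<le> of_int \<lfloor>2 ^ n * s\<rfloor> / 2 ^ n"
  proof (intro always_eventually allI)
    fix n :: nat
    have "(2 ^ n * s - 1) / 2 ^ n \<le> of_int \<lfloor>2 ^ n * s\<rfloor> / 2 ^ n"
      by (intro divide_right_mono) (linarith, simp)
    then show "s - (1/2) ^ n \<le> of_int \<lfloor>2 ^ n * s\<rfloor> / 2 ^ n"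
      by (simp add: diff_divide_distrib power_divide)
  qed
  show "\<forall>\<^sub>F n in sequentially. of_int \<lfloor>2 ^ n * s\<rfloor> / 2 ^ n \<le> s"
    using of_int_floor_le[of "2 ^ n * s" for n] by (simp add: field_simps)
qed simp

text \<open>A limit of functions that are constant on dyadic intervals is strongly measurable: cutting off
  the argument at \<open>n\<close> leaves finitely many intervals, hence simple functions, and does not change the
  limit at any point.\<close>

lemma strongly_measurable_dyadic:
  fixes f :: "real \<Rightarrow> 'a::topological_space"
  assumes "AE s in lebesgue_on {0<..}. (\<lambda>n. G n \<lfloor>2 ^ n * s\<rfloor>) \<longlonglongrightarrow> f s"
  shows "strongly_measurable (lebesgue_on {0<..}) f"
  unfolding strongly_measurable_def
proof (intro exI conjI allI)
  let ?k = "\<lambda>n s. \<lfloor>2 ^ n * min s (real n)\<rfloor>"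
  show "simple_function (lebesgue_on {0<..}) (\<lambda>s. G n (?k n s))" for n
  proof (rule simple_function_compose1[where g="G n"])
    have "?k n s \<in> {0..int (2 ^ n * n)}" if "s > 0" for s
    proof -
      have "2 ^ n * min s (real n) \<le> 2 ^ n * real n" by simp
      also have "\<dots> = of_int (int (2 ^ n * n))" by simp
      finally have "?k n s \<le> int (2 ^ n * n)" by (metis floor_mono floor_of_int)
      then show ?thesis using that by simp
    qed
    then have "?k n ` {0<..} \<subseteq> {0..int (2 ^ n * n)}" by auto
    then have "finite (?k n ` {0<..})" by (rule finite_subset) simp
    moreover have "?k n \<in> measurable (lebesgue_on {0<..}) (count_space UNIV)"
    proof -
      have "?k n \<in> measurable lborel (count_space UNIV)" by measurable
      then have "?k n \<in> measurable lebesgue (count_space UNIV)" by (rule measurable_completion)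
      then show ?thesis by (rule measurable_restrict_space1)
    qed
    then have "?k n -` {x} \<inter> space (lebesgue_on {0<..}) \<in> sets (lebesgue_on {0<..})" for x
      by (rule measurable_sets) simp
    ultimately show "simple_function (lebesgue_on {0<..}) (?k n)"
      by (simp add: simple_function_def)
  qed
  show "AE s in lebesgue_on {0<..}. (\<lambda>n. G n (?k n s)) \<longlonglongrightarrow> f s"
    using assms
  proof eventually_elim
    case (elim s)
    obtain m :: nat where m: "s \<le> real m" using real_arch_simple by blast
    have "\<forall>\<^sub>F n in sequentially. G n \<lfloor>2 ^ n * s\<rfloor> = G n (?k n s)"
      using eventually_ge_at_top[of m]
    proof eventually_elim
      case (elim n)
      then have "min s (real n) = s" using m by simp
      then show ?case by simp
    qed
    with elim show ?case by (rule Lim_transform_eventually)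
  qed
qed

lemma strongly_measurable_continuous:
  fixes f :: "real \<Rightarrow> 'a::topological_space"
  assumes "continuous_on {0<..} f"
  shows "strongly_measurable (lebesgue_on {0<..}) f"
proof (rule strongly_measurable_dyadic[where G="\<lambda>n k. f (of_int k / 2 ^ n)"], rule AE_I2)
  fix s :: real assume "s \<in> space (lebesgue_on {0<..})"
  then have s: "s > 0" by simp
  then have "isCont f s" using assms by (auto simp: continuous_on_eq_continuous_at)
  then show "(\<lambda>n. f (of_int \<lfloor>2 ^ n * s\<rfloor> / 2 ^ n)) \<longlonglongrightarrow> f s"
    by (rule isCont_tendsto_compose) (rule tendsto_dyadic_floor)
qed

text \<open>The linearization errors at the two end points are small compared with their distances from \<open>s\<close>,
  and these distances add up to the length of the interval because \<open>s\<close> lies between the end points.\<close>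

lemma tendsto_straddling_quotient:
  fixes w :: "real \<Rightarrow> 'a::real_normed_vector"
  assumes d: "(w has_vector_derivative d) (at s)"
    and a: "a \<longlonglongrightarrow> s" "\<And>n. a n \<le> s" and b: "b \<longlonglongrightarrow> s" "\<And>n. s < b n"
  shows "(\<lambda>n::nat. (w (b n) - w (a n)) /\<^sub>R (b n - a n)) \<longlonglongrightarrow> d"
proof (rule tendstoI)
  fix e :: real assume e: "e > 0"
  obtain \<delta> where \<delta>: "\<delta> > 0"
    and D: "\<And>y. norm (y - s) < \<delta> \<Longrightarrow> norm (w y - w s - (y - s) *\<^sub>R d) \<le> e/2 * norm (y - s)"
    using d e unfolding has_vector_derivative_def has_derivative_at_alt
    by (metis half_gt_zero)
  have "\<forall>\<^sub>F n in sequentially. norm (a n - s) < \<delta>" "\<forall>\<^sub>F n in sequentially. norm (b n - s) < \<delta>"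
    using tendstoD[OF a(1) \<delta>] tendstoD[OF b(1) \<delta>] by (simp_all add: dist_norm)
  then show "\<forall>\<^sub>F n in sequentially. dist ((w (b n) - w (a n)) /\<^sub>R (b n - a n)) d < e"
  proof eventually_elim
    case (elim n)
    have pos: "b n - a n > 0" using a(2)[of n] b(2)[of n] by simp
    have "norm (w (b n) - w (a n) - (b n - a n) *\<^sub>R d)
        = norm ((w (b n) - w s - (b n - s) *\<^sub>R d) - (w (a n) - w s - (a n - s) *\<^sub>R d))"
      by (simp add: algebra_simps)
    also have "\<dots> \<le> e/2 * norm (b n - s) + e/2 * norm (a n - s)"
      using D[OF elim(1)] D[OF elim(2)] by (smt (verit) norm_triangle_ineq4)
    also have "\<dots> = e/2 * (b n - s) + e/2 * (s - a n)" using a(2)[of n] b(2)[of n] by simp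
    also have "\<dots> = e/2 * (b n - a n)" unfolding distrib_left[symmetric] by simp
    finally have *: "norm (w (b n) - w (a n) - (b n - a n) *\<^sub>R d) \<le> e/2 * (b n - a n)" .
    have "(w (b n) - w (a n)) /\<^sub>R (b n - a n) - d
        = (w (b n) - w (a n) - (b n - a n) *\<^sub>R d) /\<^sub>R (b n - a n)"
      using pos by (simp add: scaleR_diff_right)
    then have "dist ((w (b n) - w (a n)) /\<^sub>R (b n - a n)) d
        = norm (w (b n) - w (a n) - (b n - a n) *\<^sub>R d) / (b n - a n)"
      using pos by (simp add: dist_norm divide_inverse mult.commute)
    also have "\<dots> \<le> e/2" using * pos by (simp add: field_simps)
    finally show ?case using e by simp
  qed
qed

text \<open>The dyadic interval of length \<open>2\<^sup>-\<^sup>n\<close> around \<open>s\<close> contains \<open>s\<close> but need not start there, which is why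
  straddling quotients are needed.\<close>

lemma strongly_measurable_derivative:
  fixes w :: "real \<Rightarrow> 'a::real_normed_vector"
  assumes "AE s in lebesgue_on {0<..}. (w has_vector_derivative g s) (at s)"
  shows "strongly_measurable (lebesgue_on {0<..}) g"
proof (rule strongly_measurable_dyadic
    [where G="\<lambda>n k. (w ((of_int k + 1) / 2 ^ n) - w (of_int k / 2 ^ n)) /\<^sub>R ((of_int k + 1) / 2 ^ n - of_int k / 2 ^ n)"])
  show "AE s in lebesgue_on {0<..}. (\<lambda>n. (w ((of_int \<lfloor>2 ^ n * s\<rfloor> + 1) / 2 ^ n) - w (of_int \<lfloor>2 ^ n * s\<rfloor> / 2 ^ n)) /\<^sub>R
            ((of_int \<lfloor>2 ^ n * s\<rfloor> + 1) / 2 ^ n - of_int \<lfloor>2 ^ n * s\<rfloor> / 2 ^ n)) \<longlonglongrightarrow> g s"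
    using assms
  proof eventually_elim
    case (elim s)
    then show ?case
    proof (rule tendsto_straddling_quotient)
      show "(\<lambda>n. of_int \<lfloor>2 ^ n * s\<rfloor> / 2 ^ n) \<longlonglongrightarrow> s" by (rule tendsto_dyadic_floor)
      show "of_int \<lfloor>2 ^ n * s\<rfloor> / 2 ^ n \<le> s" for n :: nat
        using of_int_floor_le[of "2 ^ n * s"] by (simp add: field_simps)
      show "s < (of_int \<lfloor>2 ^ n * s\<rfloor> + 1) / 2 ^ n" for n :: nat
        using floor_correct[of "2 ^ n * s"] by (simp add: field_simps)
      have "(\<lambda>n. of_int \<lfloor>2 ^ n * s\<rfloor> / 2 ^ n + (1/2) ^ n) \<longlonglongrightarrow> s + 0"
        by (intro tendsto_add tendsto_dyadic_floor LIMSEQ_realpow_zero) auto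
      then show "(\<lambda>n. (of_int \<lfloor>2 ^ n * s\<rfloor> + 1) / 2 ^ n) \<longlonglongrightarrow> s"
        by (simp add: add_divide_distrib power_divide)
    qed
  qed
qed

text \<open>Translation invariance of the Lebesgue measure moves the difference quotient from \<open>f\<close> to the smooth
  factor \<open>\<phi>\<close>; the Lipschitz bounds on both factors then let the step size tend to \<open>0\<close> under the
  integral sign.\<close>

lemma integration_by_parts_Lipschitz:
  fixes f \<phi> \<phi>' g :: "real \<Rightarrow> real"
  assumes f: "\<And>x y. \<bar>f y - f x\<bar> \<le> L * \<bar>y - x\<bar>"
    and \<phi>: "\<And>x. (\<phi> has_real_derivative \<phi>' x) (at x)" "continuous_on UNIV \<phi>'"
    and supp: "\<And>x. x \<notin> {a..b} \<Longrightarrow> \<phi> x = 0" and ab: "a \<le> b"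
    and N: "countable N" "\<And>x. x \<in> N \<Longrightarrow> g x = 0"
    and g: "\<And>x. x \<notin> N \<Longrightarrow> \<phi> x \<noteq> 0 \<Longrightarrow> (f has_real_derivative g x) (at x)"
  shows "(\<lambda>x. \<phi> x * g x) \<in> borel_measurable borel"
    and "(LINT x|lborel. \<phi>' x * f x) = - (LINT x|lborel. \<phi> x * g x)"
proof -
  define h :: "nat \<Rightarrow> real" where "h n = inverse (real (Suc n))" for n
  have h: "h n > 0" "h n \<le> 1" for n by (auto simp: h_def field_simps)
  have h0: "h \<longlonglongrightarrow> 0" unfolding h_def by (rule LIMSEQ_inverse_real_of_nat)
  have hat: "filterlim h (at 0) sequentially"
    using h0 h by (auto simp: filterlim_at less_imp_neq[symmetric] intro!: always_eventually)
  have contf: "continuous_on A f" for A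
    by (rule continuous_on_subset[OF lipschitz_on_continuous_on[of L UNIV]])
       (use f[of 0 1] f in \<open>auto simp: lipschitz_on_def dist_real_def\<close>)
  have cont\<phi>: "continuous_on A \<phi>" for A
    by (intro continuous_at_imp_continuous_on ballI) (rule DERIV_isCont[OF \<phi>(1)])
  have [measurable]: "f \<in> borel_measurable borel" "\<phi> \<in> borel_measurable borel"
      "\<phi>' \<in> borel_measurable borel" "N \<in> sets borel"
    using contf[of UNIV] cont\<phi>[of UNIV] \<phi>(2) N(1)
    by (auto intro: borel_measurable_continuous_onI sets.countable)
  define I :: "real set" where "I = {a..b + 1}"
  have "compact I" by (simp add: I_def)
  obtain M where M: "\<And>x. x \<in> I \<Longrightarrow> \<bar>f x\<bar> \<le> M"
    using compact_imp_bounded[OF compact_continuous_image[OF contf \<open>compact I\<close>]]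
    by (auto simp: bounded_iff)
  obtain C where C: "\<And>x. x \<in> I \<Longrightarrow> \<bar>\<phi> x\<bar> \<le> C"
    using compact_imp_bounded[OF compact_continuous_image[OF cont\<phi> \<open>compact I\<close>]]
    by (auto simp: bounded_iff)
  have "compact {a - 1..b + 1}" by simp
  then have "bounded (\<phi>' ` {a - 1..b + 1})"
    by (intro compact_imp_bounded compact_continuous_image continuous_on_subset[OF \<phi>(2)]) auto
  then obtain K where K: "\<And>x. x \<in> {a - 1..b + 1} \<Longrightarrow> \<bar>\<phi>' x\<bar> \<le> K"
    unfolding bounded_iff by (metis image_eqI real_norm_def)
  have M0: "M \<ge> 0" and C0: "C \<ge> 0" and K0: "K \<ge> 0" and L0: "L \<ge> 0"
    using M[of a] C[of a] K[of a] f[of 0 1] ab by (auto simp: I_def)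
  have intI: "integrable lborel (\<lambda>x. c * indicator I x)" for c :: real
    by (intro integrable_mult_right integrable_real_indicator) (simp_all add: I_def emeasure_lborel_Icc_eq)
  \<comment> \<open>The discrete integration by parts reads \<open>\<integral> \<phi> q\<^sub>n = \<integral> p\<^sub>n f\<close>.\<close>
  define q where "q n x = (f (x + h n) - f x) / h n" for n x
  define p where "p n x = (\<phi> (x - h n) - \<phi> x) / h n" for n x
  have [measurable]: "q n \<in> borel_measurable borel" "p n \<in> borel_measurable borel" for n
    unfolding q_def p_def by measurable
  have q_le: "\<bar>q n x\<bar> \<le> L" for n x
    using f[of "x + h n" x] h(1)[of n] by (simp add: q_def field_simps)
  have \<phi>I: "\<phi> x = 0" if "x \<notin> I" for x using supp[of x] that by (auto simp: I_def)
  have \<phi>hI: "\<phi> (x - h n) = 0" if "x \<notin> I" for x n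
    using supp[of "x - h n"] that h[of n] by (auto simp: I_def)
  have p_le: "\<bar>p n x\<bar> \<le> K * indicator I x" for n x
  proof (cases "x \<in> I")
    case True
    have "\<bar>\<phi> x - \<phi> (x - h n)\<bar> \<le> K * \<bar>x - (x - h n)\<bar>"
      unfolding real_norm_def[symmetric]
    proof (rule field_differentiable_bound[of "{a - 1..b + 1}" \<phi> \<phi>'])
      show "(\<phi> has_field_derivative \<phi>' z) (at z within {a - 1..b + 1})" for z
        using \<phi>(1)[of z] by (rule has_field_derivative_at_within)
    qed (use True h[of n] K in \<open>auto simp: I_def\<close>)
    then show ?thesis using True h(1)[of n] by (simp add: p_def field_simps abs_minus_commute)
  qed (simp add: p_def \<phi>I \<phi>hI)
  \<comment> \<open>On \<open>N\<close> the quotients may diverge; removing this null set gives convergence at every point,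
    and with it the measurability of the limit.\<close>
  have q_lim: "(\<lambda>n. indicator (- N) x * (\<phi> x * q n x)) \<longlonglongrightarrow> \<phi> x * g x" for x
  proof (cases "x \<in> N \<or> \<phi> x = 0")
    case False
    then have "((\<lambda>y. (f (x + y) - f x) / y) \<longlongrightarrow> g x) (at 0)"
      using g[of x] by (simp add: DERIV_def)
    then have "(\<lambda>n. q n x) \<longlonglongrightarrow> g x"
      unfolding q_def by (rule filterlim_compose) (rule hat)
    then show ?thesis using False by (auto intro: tendsto_intros)
  qed (auto simp: N)
  show meas: "(\<lambda>x. \<phi> x * g x) \<in> borel_measurable borel"
    by (rule borel_measurable_LIMSEQ_real[OF q_lim]) measurable
  have p_lim: "(\<lambda>n. p n x * f x) \<longlonglongrightarrow> - \<phi>' x * f x" for x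
  proof -
    have "filterlim (\<lambda>n. - h n) (at 0) sequentially"
      using tendsto_minus[OF h0] h by (auto simp: filterlim_at less_imp_neq[symmetric] intro!: always_eventually)
    moreover have "((\<lambda>y. (\<phi> (x + y) - \<phi> x) / y) \<longlongrightarrow> \<phi>' x) (at 0)"
      using \<phi>(1)[of x] by (simp add: DERIV_def)
    ultimately have "(\<lambda>n. (\<phi> (x + - h n) - \<phi> x) / (- h n)) \<longlonglongrightarrow> \<phi>' x"
      by (rule filterlim_compose[rotated])
    then have "(\<lambda>n. - ((\<phi> (x + - h n) - \<phi> x) / (- h n)) * f x) \<longlonglongrightarrow> - \<phi>' x * f x"
      by (intro tendsto_intros)
    then show ?thesis by (simp add: p_def)
  qed
  have "(\<lambda>n. LINT x|lborel. indicator (- N) x * (\<phi> x * q n x)) \<longlonglongrightarrow> (LINT x|lborel. \<phi> x * g x)"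
  proof (rule integral_dominated_convergence)
    show "AE x in lborel. norm (indicator (- N) x * (\<phi> x * q n x)) \<le> (C * L) * indicator I x" for n
    proof (rule AE_I2)
      fix x
      have "\<bar>\<phi> x * q n x\<bar> \<le> (C * L) * indicator I x"
        using C[of x] q_le[of n x] C0 by (cases "x \<in> I") (auto simp: abs_mult \<phi>I intro!: mult_mono)
      then show "norm (indicator (- N) x * (\<phi> x * q n x)) \<le> (C * L) * indicator I x"
        by (auto simp: indicator_def split: if_splits)
    qed
  qed (use meas q_lim intI in \<open>auto\<close>)
  moreover have "(\<lambda>n. LINT x|lborel. p n x * f x) \<longlonglongrightarrow> (LINT x|lborel. - \<phi>' x * f x)"
  proof (rule integral_dominated_convergence)
    show "AE x in lborel. norm (p n x * f x) \<le> (K * M) * indicator I x" for n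
    proof (rule AE_I2)
      fix x
      show "norm (p n x * f x) \<le> (K * M) * indicator I x"
        using M[of x] p_le[of n x] K0 by (cases "x \<in> I") (auto simp: abs_mult intro!: mult_mono)
    qed
  qed (use p_lim intI in auto)
  moreover have "(LINT x|lborel. indicator (- N) x * (\<phi> x * q n x)) = (LINT x|lborel. p n x * f x)" for n
  proof -
    have i1: "integrable lborel (\<lambda>x. \<phi> x * f (x + h n))"
    proof (rule Bochner_Integration.integrable_bound[OF intI[of "C * (M + L)"]])
      show "AE x in lborel. norm (\<phi> x * f (x + h n)) \<le> norm (C * (M + L) * indicator I x)"
      proof (rule AE_I2)
        fix x
        have "L * h n \<le> L" using h[of n] L0 by (simp add: mult_left_le)
        then have "\<bar>f (x + h n)\<bar> \<le> M + L" if "x \<in> I"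
          using f[of "x + h n" x] M[OF that] h(1)[of n] by simp
        then show "norm (\<phi> x * f (x + h n)) \<le> norm (C * (M + L) * indicator I x)"
          using C[of x] C0 M0 L0 by (cases "x \<in> I") (auto simp: abs_mult \<phi>I intro!: mult_mono)
      qed
    qed measurable
    have i2: "integrable lborel (\<lambda>x. \<phi> x * f x)"
    proof (rule Bochner_Integration.integrable_bound[OF intI[of "C * M"]])
      show "AE x in lborel. norm (\<phi> x * f x) \<le> norm (C * M * indicator I x)"
      proof (rule AE_I2)
        fix x show "norm (\<phi> x * f x) \<le> norm (C * M * indicator I x)"
          using C[of x] M[of x] C0 M0 by (cases "x \<in> I") (auto simp: abs_mult \<phi>I intro!: mult_mono)
      qed
    qed measurable
    have shift: "(LINT x|lborel. \<phi> x * f (x + h n)) = (LINT x|lborel. \<phi> (x - h n) * f x)"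
      using lborel_integral_real_affine[of 1 "\<lambda>x. \<phi> (x - h n) * f x" "h n"] by (simp add: add.commute)
    have i3: "integrable lborel (\<lambda>x. \<phi> (x - h n) * f x)"
      using lborel_integrable_real_affine[OF i1, of 1 "- h n"] by simp
    have "(LINT x|lborel. indicator (- N) x * (\<phi> x * q n x)) = (LINT x|lborel. \<phi> x * q n x)"
    proof (rule integral_cong_AE)
      have "AE x in lborel. x \<notin> N"
        using N(1) by (intro AE_not_in countable_imp_null_set_lborel)
      then show "AE x in lborel. indicator (- N) x * (\<phi> x * q n x) = \<phi> x * q n x"
        by eventually_elim simp
    qed measurable
    also have "\<dots> = (LINT x|lborel. (\<phi> x * f (x + h n) - \<phi> x * f x) / h n)"
      by (simp add: q_def algebra_simps)
    also have "\<dots> = ((LINT x|lborel. \<phi> (x - h n) * f x) - (LINT x|lborel. \<phi> x * f x)) / h n"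
      using i1 i2 by (simp add: shift)
    also have "\<dots> = (LINT x|lborel. (\<phi> (x - h n) * f x - \<phi> x * f x) / h n)"
      using i3 i2 by simp
    also have "\<dots> = (LINT x|lborel. p n x * f x)" by (simp add: p_def algebra_simps)
    finally show ?thesis .
  qed
  ultimately have "(LINT x|lborel. \<phi> x * g x) = (LINT x|lborel. - \<phi>' x * f x)"
    using LIMSEQ_unique by simp
  then show "(LINT x|lborel. \<phi>' x * f x) = - (LINT x|lborel. \<phi> x * g x)" by simp
qed


lemma weak_derivative_locally_Lipschitz:
  fixes w :: "real \<Rightarrow> 'a::real_inner"
  assumes lip: "\<And>a. a > 0 \<Longrightarrow> \<exists>L. \<forall>x\<ge>a. \<forall>y\<ge>a. norm (w y - w x) \<le> L * \<bar>y - x\<bar>"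
    and N: "countable N" "\<And>s. s \<in> N \<Longrightarrow> g s = 0"
    and g: "\<And>s. s > 0 \<Longrightarrow> s \<notin> N \<Longrightarrow> (w has_vector_derivative g s) (at s)"
  shows "weak_derivative w g"
  unfolding weak_derivative_def
proof (intro allI impI)
  fix \<phi> :: "real \<Rightarrow> real" and x :: 'a
  assume \<phi>: "test_function \<phi>"
  then obtain a0 b0 where a0: "a0 > 0" and b0: "\<And>s. s \<notin> {a0..b0} \<Longrightarrow> \<phi> s = 0"
    unfolding test_function_def by blast
  define a b where "a = a0 / 2" and "b = max a0 b0"
  have a: "a > 0" "a < a0" and ab: "a0 \<le> b"
    using a0 by (auto simp: a_def b_def)
  have supp: "\<phi> s = 0" if "s \<notin> {a0..b}" for s
    using that by (intro b0) (auto simp: b_def)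
  have "((deriv ^^ n) \<phi>) differentiable (at s)" for n s
    using \<phi> by (simp add: test_function_def)
  from this[of 0] this[of 1] have d0: "\<And>s. \<phi> differentiable (at s)" and d1: "\<And>s. deriv \<phi> differentiable (at s)"
    by simp_all
  have d: "(\<phi> has_real_derivative deriv \<phi> s) (at s)" for s
    using d0[of s] by (simp add: DERIV_deriv_iff_real_differentiable)
  have dc: "continuous_on UNIV (deriv \<phi>)"
    using d1 by (auto intro!: continuous_at_imp_continuous_on differentiable_imp_continuous_within)
  have dsupp: "deriv \<phi> s = 0" if "s \<notin> {a0..b}" for s
  proof -
    have "\<forall>\<^sub>F y in nhds s. \<phi> y = 0"
      using that by (intro eventually_nhds_in_open[of "- {a0..b}" s, THEN eventually_mono]) (auto intro: supp)
    then have "deriv \<phi> s = deriv (\<lambda>_. 0) s" by (intro deriv_cong_ev) auto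
    then show ?thesis by simp
  qed
  obtain L where L: "\<And>p q. a \<le> p \<Longrightarrow> a \<le> q \<Longrightarrow> norm (w q - w p) \<le> L * \<bar>q - p\<bar>"
    using lip[OF a(1)] by blast
  have L0: "L \<ge> 0" using order_trans[OF norm_ge_zero L[of a "a + 1"]] by simp
  \<comment> \<open>Freezing the function to the left of \<open>a\<close> makes it Lipschitz on the whole line.\<close>
  define f where "f s = inner (w (max a s)) x" for s
  have fL: "\<bar>f q - f p\<bar> \<le> (L * norm x) * \<bar>q - p\<bar>" for p q
  proof -
    have "\<bar>f q - f p\<bar> \<le> norm (w (max a q) - w (max a p)) * norm x"
      by (simp add: f_def inner_diff_left[symmetric] Cauchy_Schwarz_ineq2)
    also have "\<dots> \<le> (L * \<bar>max a q - max a p\<bar>) * norm x"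
      by (intro mult_right_mono L) auto
    also have "\<dots> \<le> (L * \<bar>q - p\<bar>) * norm x"
      by (intro mult_right_mono mult_left_mono L0) auto
    finally show ?thesis by (simp add: mult_ac)
  qed
  have fd: "(f has_real_derivative inner (g s) x) (at s)" if "s \<notin> N" "\<phi> s \<noteq> 0" for s
  proof -
    have s: "s > a" using supp[of s] that a by force
    have "((\<lambda>s. inner (w s) x) has_vector_derivative inner (g s) x) (at s)"
      using g[of s] that s a by (intro bounded_linear.has_vector_derivative[OF bounded_linear_inner_left]) auto
    then have "(f has_vector_derivative inner (g s) x) (at s)"
      by (rule has_vector_derivative_transform_within_open[where S="{a<..}"]) (use s in \<open>auto simp: f_def\<close>)
    then show ?thesis by (simp add: has_real_derivative_iff_has_vector_derivative)
  qed
  have meas: "(\<lambda>s. \<phi> s * inner (g s) x) \<in> borel_measurable borel"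
    and eq: "(LINT s|lborel. deriv \<phi> s * f s) = - (LINT s|lborel. \<phi> s * inner (g s) x)"
    using integration_by_parts_Lipschitz[OF fL d dc supp ab N(1) _ fd] N(2) by simp_all
  have fm [measurable]: "f \<in> borel_measurable borel"
    by (intro borel_measurable_continuous_onI lipschitz_on_continuous_on[of "L * norm x" UNIV])
       (use fL L0 in \<open>auto simp: lipschitz_on_def dist_real_def\<close>)
  have [measurable]: "deriv \<phi> \<in> borel_measurable borel"
    by (rule borel_measurable_continuous_onI[OF dc])
  have "(LINT s:{0<..}|lebesgue. deriv \<phi> s * inner (w s) x) = (LINT s|lebesgue. deriv \<phi> s * f s)"
    unfolding set_lebesgue_integral_def
    by (rule Bochner_Integration.integral_cong)
       (use a dsupp in \<open>auto simp: f_def indicator_def max_def\<close>)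
  also have "\<dots> = (LINT s|lborel. deriv \<phi> s * f s)"
    by (rule integral_completion) measurable
  also have "\<dots> = - (LINT s|lebesgue. \<phi> s * inner (g s) x)"
    unfolding eq using meas by (subst integral_completion) simp_all
  also have "(LINT s|lebesgue. \<phi> s * inner (g s) x) = (LINT s:{0<..}|lebesgue. \<phi> s * inner (g s) x)"
    unfolding set_lebesgue_integral_def
    by (rule Bochner_Integration.integral_cong)
       (use a supp in \<open>auto simp: indicator_def\<close>)
  finally show "(LINT s:{0<..}|lebesgue. deriv \<phi> s * inner (w s) x)
      = - (LINT s:{0<..}|lebesgue. \<phi> s * inner (g s) x)" .
qed

lemma L2_loc_locally_bounded:
  assumes "strongly_measurable (lebesgue_on {0<..}) f"
    and "\<And>a b. 0 < a \<Longrightarrow> a < b \<Longrightarrow> \<exists>B. \<forall>s\<in>{a..b}. norm (f s) \<le> B"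
  shows "L2_loc f"
  unfolding L2_loc_def
proof (intro conjI allI impI)
  fix a b :: real assume ab: "0 < a \<and> a < b"
  then obtain B where B: "\<And>s. s \<in> {a..b} \<Longrightarrow> norm (f s) \<le> B" using assms(2) by blast
  have "(\<integral>\<^sup>+s\<in>{a..b}. ennreal ((norm (f s))\<^sup>2) \<partial>lebesgue) \<le> (\<integral>\<^sup>+s. ennreal (B\<^sup>2) * indicator {a..b} s \<partial>lebesgue)"
    by (intro nn_integral_mono) (auto simp: indicator_def intro!: ennreal_leI power_mono B)
  also have "\<dots> = ennreal (B\<^sup>2) * emeasure lebesgue {a..b}"
    by (rule nn_integral_cmult_indicator) simp
  also have "\<dots> < \<infinity>" using ab by (simp add: ennreal_mult_less_top)
  finally show "(\<integral>\<^sup>+s\<in>{a..b}. ennreal ((norm (f s))\<^sup>2) \<partial>lebesgue) < \<infinity>" .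
qed fact

lemma continuous_on_locally_Lipschitz:
  fixes w :: "real \<Rightarrow> 'a::real_normed_vector"
  assumes lip: "\<And>a. a > 0 \<Longrightarrow> \<exists>L. \<forall>x\<ge>a. \<forall>y\<ge>a. norm (w y - w x) \<le> L * \<bar>y - x\<bar>"
  shows "continuous_on {0<..} w"
proof (rule continuous_at_imp_continuous_on, rule ballI)
  fix s :: real assume "s \<in> {0<..}"
  then have s: "s > 0" by simp
  obtain L where L: "\<And>p q. s/2 \<le> p \<Longrightarrow> s/2 \<le> q \<Longrightarrow> norm (w q - w p) \<le> L * \<bar>q - p\<bar>"
    using lip[of "s/2"] s by auto
  have "L \<ge> 0" using order_trans[OF norm_ge_zero L[of s "s + 1"]] s by simp
  then have "L-lipschitz_on {s/2<..} w"
    using L by (auto simp: lipschitz_on_def dist_norm norm_minus_commute abs_minus_commute)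
  then have "continuous_on {s/2<..} w" by (rule lipschitz_on_continuous_on)
  then show "isCont w s" using s by (auto simp: continuous_on_eq_continuous_at)
qed

lemma H1_loc_locally_Lipschitz:
  fixes w :: "real \<Rightarrow> 'a::real_inner"
  assumes lip: "\<And>a. a > 0 \<Longrightarrow> \<exists>L. \<forall>x\<ge>a. \<forall>y\<ge>a. norm (w y - w x) \<le> L * \<bar>y - x\<bar>"
    and N: "countable N" "\<And>s. s > 0 \<Longrightarrow> s \<notin> N \<Longrightarrow> w differentiable (at s)"
  shows "H1_loc w"
proof -
  define g where "g s = (if s \<in> N then 0 else vector_derivative w (at s))" for s
  have g: "(w has_vector_derivative g s) (at s)" if "s > 0" "s \<notin> N" for s
    using N(2)[OF that] that by (simp add: g_def vector_derivative_works)
  have cont: "continuous_on {0<..} w" by (rule continuous_on_locally_Lipschitz[OF lip])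
  have gb: "\<exists>B. \<forall>s\<in>{a..b}. norm (g s) \<le> B" if a: "a > 0" for a b
  proof -
    obtain L where L: "\<And>p q. a/2 \<le> p \<Longrightarrow> a/2 \<le> q \<Longrightarrow> norm (w q - w p) \<le> L * \<bar>q - p\<bar>"
      using lip[of "a/2"] a by auto
    have L0: "L \<ge> 0" using order_trans[OF norm_ge_zero L[of a "a + 1"]] a by simp
    have "norm (g s) \<le> L" if s: "s \<in> {a..b}" for s
    proof (cases "s \<in> N")
      case False
      define k where "k n = inverse (real (Suc n))" for n
      have k: "k n > 0" for n by (simp add: k_def)
      have "(\<lambda>n. s + k n) \<longlonglongrightarrow> s" unfolding k_def by (rule LIMSEQ_inverse_real_of_nat_add)
      then have "(\<lambda>n. (w (s + k n) - w s) /\<^sub>R (s + k n - s)) \<longlonglongrightarrow> g s"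
        using s a False k by (intro tendsto_straddling_quotient[OF g]) auto
      then have lim: "(\<lambda>n. norm ((w (s + k n) - w s) /\<^sub>R (s + k n - s))) \<longlonglongrightarrow> norm (g s)"
        by (rule tendsto_norm)
      have "norm ((w (s + k n) - w s) /\<^sub>R (s + k n - s)) \<le> L" for n
      proof -
        have "norm ((w (s + k n) - w s) /\<^sub>R (s + k n - s)) = norm (w (s + k n) - w s) / k n"
          using k[of n] by (simp add: divide_inverse mult.commute)
        then show ?thesis using L[of s "s + k n"] s a k[of n] by (simp add: pos_divide_le_eq)
      qed
      then show ?thesis by (intro LIMSEQ_le_const2[OF lim]) blast
    qed (simp add: g_def L0)
    then show ?thesis by blast
  qed
  have "AE s in lebesgue. s \<notin> N"
    using N(1) by (intro AE_not_in) (simp add: countable_imp_null_set_lborel null_sets_completionI)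
  then have "AE s in lebesgue_on {0<..}. (w has_vector_derivative g s) (at s)"
    by (subst AE_restrict_space_iff) (auto elim!: eventually_mono intro: g)
  then have "L2_loc g"
    by (intro L2_loc_locally_bounded strongly_measurable_derivative gb)
  moreover have "L2_loc w"
  proof (intro L2_loc_locally_bounded strongly_measurable_continuous cont)
    fix a b :: real assume "0 < a" "a < b"
    then have "compact (w ` {a..b})"
      by (intro compact_continuous_image continuous_on_subset[OF cont]) auto
    then have "bounded (w ` {a..b})" by (rule compact_imp_bounded)
    then show "\<exists>B. \<forall>s\<in>{a..b}. norm (w s) \<le> B" by (auto simp: bounded_iff)
  qed
  moreover have "weak_derivative w g"
    by (rule weak_derivative_locally_Lipschitz[OF lip N(1) _ g]) (simp_all add: g_def)
  ultimately show ?thesis by (auto simp: H1_loc_def)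
qed

section \<open>Curves of maximal slope\<close>

text \<open>A functional with values in \<open>[0,\<infinity>]\<close> is represented here by its real values \<open>F\<close> on its domain \<open>D\<close>.
  In \<open>descent\<close> the rate is taken at the later time: this is the weaker bound, and the one that
  remains valid when \<open>\<rho>\<close> jumps between \<open>s\<close> and \<open>t\<close>. At continuity points of \<open>\<rho>\<close> the bounds add up to
  the energy identity \<open>-(F \<circ> w)' = \<parallel>w'\<parallel> \<rho> = \<rho>\<^sup>2\<close>.\<close>

locale maximal_slope_curve =
  fixes F :: "'a::{real_inner, complete_space} \<Rightarrow> real" and D :: "'a set"
    and w :: "real \<Rightarrow> 'a" and \<rho> :: "real \<Rightarrow> real"
  assumes convex_dom: "\<And>x y c. x \<in> D \<Longrightarrow> y \<in> D \<Longrightarrow> 0 \<le> c \<Longrightarrow> c \<le> 1 \<Longrightarrow> (1 - c) *\<^sub>R x + c *\<^sub>R y \<in> D"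
    and convex: "\<And>x y c. x \<in> D \<Longrightarrow> y \<in> D \<Longrightarrow> 0 \<le> c \<Longrightarrow> c \<le> 1 \<Longrightarrow>
      F ((1 - c) *\<^sub>R x + c *\<^sub>R y) \<le> (1 - c) * F x + c * F y"
    and in_dom: "\<And>s. 0 < s \<Longrightarrow> w s \<in> D"
    and speed: "\<And>s t. 0 < s \<Longrightarrow> s < t \<Longrightarrow> norm (w t - w s) \<le> \<rho> s * (t - s)"
    and descent: "\<And>s t. 0 < s \<Longrightarrow> s < t \<Longrightarrow> F (w t) \<le> F (w s) - (\<rho> t)\<^sup>2 * (t - s)"
    and slope: "\<And>s v. 0 < s \<Longrightarrow> v \<in> D \<Longrightarrow> F (w s) \<le> F v + \<rho> s * norm (v - w s)"
    and rho_nonneg: "\<And>s. 0 < s \<Longrightarrow> 0 \<le> \<rho> s"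
    and rho_antimono: "\<And>s t. 0 < s \<Longrightarrow> s \<le> t \<Longrightarrow> \<rho> t \<le> \<rho> s"
begin

definition quotient :: "real \<Rightarrow> real \<Rightarrow> 'a" where
  "quotient s t = (w t - w s) /\<^sub>R (t - s)"

lemma norm_quotient_le: "0 < s \<Longrightarrow> s < t \<Longrightarrow> norm (quotient s t) \<le> \<rho> s"
  using speed[of s t] by (simp add: quotient_def divide_inverse_commute[symmetric] pos_divide_le_eq mult.commute)

text \<open>Move from \<open>w s\<close> by the same small amount \<open>\<tau>\<close> along either quotient. By convexity the energy drops
  by at least \<open>\<tau> \<rho>(t)\<^sup>2\<close>, also at the midpoint of the two new positions. The slope bound turns this
  drop into a lower bound for the norm of the mean of the two quotients, and the parallelogram
  identity into an upper bound for their difference.\<close>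

lemma quotients_close:
  assumes s: "0 < s" and t1: "s < t1" "t1 \<le> t" and t2: "s < t2" "t2 \<le> t"
  shows "(\<rho> s)\<^sup>2 * (norm (quotient s t1 - quotient s t2))\<^sup>2 \<le> 4 * ((\<rho> s) ^ 4 - (\<rho> t) ^ 4)"
proof -
  define \<tau> where "\<tau> = min (t1 - s) (t2 - s)"
  have \<tau>: "\<tau> > 0" "\<tau> \<le> t1 - s" "\<tau> \<le> t2 - s" using t1 t2 by (auto simp: \<tau>_def)
  have st: "s < t" using t1 by simp
  have step: "w s + \<tau> *\<^sub>R quotient s r \<in> D \<and> F (w s + \<tau> *\<^sub>R quotient s r) \<le> F (w s) - \<tau> * (\<rho> t)\<^sup>2"
    if r: "s < r" "r \<le> t" "\<tau> \<le> r - s" for r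
  proof -
    define c where "c = \<tau> / (r - s)"
    have c: "0 \<le> c" "c \<le> 1" "c * (r - s) = \<tau>" using \<tau> r by (auto simp: c_def)
    have eq: "w s + \<tau> *\<^sub>R quotient s r = (1 - c) *\<^sub>R w s + c *\<^sub>R w r"
      by (simp add: quotient_def c_def algebra_simps divide_inverse)
    have "F ((1 - c) *\<^sub>R w s + c *\<^sub>R w r) \<le> (1 - c) * F (w s) + c * F (w r)"
      using c r s by (intro convex in_dom) auto
    also have "\<dots> \<le> (1 - c) * F (w s) + c * (F (w s) - (\<rho> r)\<^sup>2 * (r - s))"
      using c r s by (intro add_left_mono mult_left_mono descent) auto
    also have "\<dots> = F (w s) - (c * (r - s)) * (\<rho> r)\<^sup>2" by (simp add: algebra_simps)
    also have "\<dots> = F (w s) - \<tau> * (\<rho> r)\<^sup>2" by (simp only: c)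
    also have "\<dots> \<le> F (w s) - \<tau> * (\<rho> t)\<^sup>2"
      using \<tau> r s rho_antimono[of r t] rho_nonneg[of t]
      by (intro diff_left_mono mult_left_mono power_mono) auto
    finally show ?thesis unfolding eq using c r s by (intro conjI convex_dom in_dom) auto
  qed
  define q1 q2 where "q1 = quotient s t1" and "q2 = quotient s t2"
  define m where "m = (1 - 1/2) *\<^sub>R (w s + \<tau> *\<^sub>R q1) + (1/2) *\<^sub>R (w s + \<tau> *\<^sub>R q2)"
  have x1: "w s + \<tau> *\<^sub>R q1 \<in> D" "F (w s + \<tau> *\<^sub>R q1) \<le> F (w s) - \<tau> * (\<rho> t)\<^sup>2"
    and x2: "w s + \<tau> *\<^sub>R q2 \<in> D" "F (w s + \<tau> *\<^sub>R q2) \<le> F (w s) - \<tau> * (\<rho> t)\<^sup>2"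
    using step[of t1] step[of t2] t1 t2 \<tau> by (auto simp: q1_def q2_def)
  have "F m \<le> (1 - 1/2) * F (w s + \<tau> *\<^sub>R q1) + (1/2) * F (w s + \<tau> *\<^sub>R q2)"
    unfolding m_def by (rule convex) (use x1 x2 in auto)
  also have "\<dots> \<le> F (w s) - \<tau> * (\<rho> t)\<^sup>2" using x1(2) x2(2) by simp
  finally have Fm: "F m \<le> F (w s) - \<tau> * (\<rho> t)\<^sup>2" .
  have "m \<in> D" unfolding m_def by (rule convex_dom) (use x1 x2 in auto)
  then have "F (w s) \<le> F m + \<rho> s * norm (m - w s)" by (rule slope[OF s])
  moreover have "m - w s = (\<tau> / 2) *\<^sub>R (q1 + q2)"
    by (simp add: m_def algebra_simps flip: scaleR_add_left)
  then have "norm (m - w s) = \<tau> * norm (q1 + q2) / 2" using \<tau> by simp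
  ultimately have "F (w s) \<le> F m + \<tau> * (\<rho> s * norm (q1 + q2) / 2)" by (simp add: mult_ac)
  then have "\<tau> * (\<rho> t)\<^sup>2 \<le> \<tau> * (\<rho> s * norm (q1 + q2) / 2)" using Fm by linarith
  then have "(\<rho> t)\<^sup>2 \<le> \<rho> s * norm (q1 + q2) / 2" using \<tau> by simp
  then have "((\<rho> t)\<^sup>2)\<^sup>2 \<le> (\<rho> s * norm (q1 + q2) / 2)\<^sup>2" by (rule power_mono) simp
  then have 1: "4 * (\<rho> t) ^ 4 \<le> (\<rho> s)\<^sup>2 * (norm (q1 + q2))\<^sup>2"
    by (simp add: power_divide power_mult_distrib flip: power_mult)
  have "(norm (q1 - q2))\<^sup>2 = 2 * (norm q1)\<^sup>2 + 2 * (norm q2)\<^sup>2 - (norm (q1 + q2))\<^sup>2"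
    by (simp add: power2_norm_eq_inner inner_diff inner_add inner_commute)
  also have "\<dots> \<le> 2 * (\<rho> s)\<^sup>2 + 2 * (\<rho> s)\<^sup>2 - (norm (q1 + q2))\<^sup>2"
    unfolding q1_def q2_def using s t1 t2
    by (intro diff_right_mono add_mono mult_left_mono power_mono norm_quotient_le) auto
  finally have "(norm (q1 - q2))\<^sup>2 \<le> 4 * (\<rho> s)\<^sup>2 - (norm (q1 + q2))\<^sup>2" by simp
  then have "(\<rho> s)\<^sup>2 * (norm (q1 - q2))\<^sup>2 \<le> (\<rho> s)\<^sup>2 * (4 * (\<rho> s)\<^sup>2 - (norm (q1 + q2))\<^sup>2)"
    by (rule mult_left_mono) simp
  also have "\<dots> = 4 * (\<rho> s) ^ 4 - (\<rho> s)\<^sup>2 * (norm (q1 + q2))\<^sup>2"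
    by (simp add: right_diff_distrib power4_eq_xxxx power2_eq_square)
  finally show ?thesis using 1 unfolding q1_def q2_def by simp
qed

text \<open>Where \<open>\<rho>\<close> vanishes the preceding estimate is void, but then all quotients are small.\<close>

lemma quotients_uniformly_close:
  assumes s: "0 < s" and cont: "isCont \<rho> s" and e: "0 < e"
  obtains \<eta> where "0 < \<eta>" "\<eta> < s"
    "\<And>r t t'. s - \<eta> \<le> r \<Longrightarrow> r \<le> s \<Longrightarrow> r < t \<Longrightarrow> r < t' \<Longrightarrow> t \<le> s + \<eta> \<Longrightarrow> t' \<le> s + \<eta> \<Longrightarrow>
      norm (quotient r t - quotient r t') \<le> e"
proof (cases "\<rho> s = 0")
  case True
  then obtain \<delta> where \<delta>: "\<delta> > 0" "\<And>y. dist y s < \<delta> \<Longrightarrow> dist (\<rho> y) 0 < e / 2"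
    using cont e unfolding continuous_at_eps_delta by (metis half_gt_zero)
  show thesis
  proof (rule that[of "min (\<delta> / 2) (s / 2)"])
    fix r t t' assume r: "s - min (\<delta> / 2) (s / 2) \<le> r" "r \<le> s" "r < t" "r < t'"
    then have "0 < r" "dist r s < \<delta>" using s \<delta>(1) by (auto simp: dist_real_def)
    then have "norm (quotient r t) \<le> e / 2" "norm (quotient r t') \<le> e / 2"
      using norm_quotient_le[of r t] norm_quotient_le[of r t'] r \<delta>(2)[of r] by auto
    then show "norm (quotient r t - quotient r t') \<le> e"
      by (smt (verit) norm_triangle_ineq4 field_sum_of_halves)
  qed (use s \<delta>(1) in auto)
next
  case False
  define A where "A = \<rho> s"
  have A: "A > 0" using False rho_nonneg[OF s] by (simp add: A_def)
  have "isCont (\<lambda>y. \<rho> y ^ 4) s" using cont by simp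
  moreover have "(A * e)\<^sup>2 / 8 > 0" using A e by simp
  ultimately obtain \<delta> where \<delta>: "\<delta> > 0" "\<And>y. dist y s < \<delta> \<Longrightarrow> dist (\<rho> y ^ 4) (\<rho> s ^ 4) < (A * e)\<^sup>2 / 8"
    unfolding continuous_at_eps_delta by blast
  show thesis
  proof (rule that[of "min (\<delta> / 2) (s / 2)"])
    fix r t t' assume r: "s - min (\<delta> / 2) (s / 2) \<le> r" "r \<le> s" "r < t" "r < t'"
      and t: "t \<le> s + min (\<delta> / 2) (s / 2)" "t' \<le> s + min (\<delta> / 2) (s / 2)"
    have "0 < r" "dist r s < \<delta>" "dist (max t t') s < \<delta>" using r t s \<delta>(1) by (auto simp: dist_real_def)
    then have "\<rho> r ^ 4 - \<rho> (max t t') ^ 4 \<le> (A * e)\<^sup>2 / 4"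
      using \<delta>(2)[of r] \<delta>(2)[of "max t t'"] unfolding dist_real_def by linarith
    have "A\<^sup>2 * (norm (quotient r t - quotient r t'))\<^sup>2 \<le> (\<rho> r)\<^sup>2 * (norm (quotient r t - quotient r t'))\<^sup>2"
      using rho_antimono[of r s] \<open>0 < r\<close> r(2) A by (intro mult_right_mono power_mono) (auto simp: A_def)
    also have "\<dots> \<le> 4 * (\<rho> r ^ 4 - \<rho> (max t t') ^ 4)"
      using \<open>0 < r\<close> r by (intro quotients_close) auto
    also have "\<dots> \<le> A\<^sup>2 * e\<^sup>2"
      using \<open>\<rho> r ^ 4 - \<rho> (max t t') ^ 4 \<le> (A * e)\<^sup>2 / 4\<close> by (simp add: power_mult_distrib)
    finally have "(norm (quotient r t - quotient r t'))\<^sup>2 \<le> e\<^sup>2" using A by simp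
    then show "norm (quotient r t - quotient r t') \<le> e" using e by (simp add: abs_le_square_iff[symmetric])
  qed (use s \<delta>(1) in auto)
qed

text \<open>The quotients to the right of \<open>s\<close> form a Cauchy filter, so the right derivative exists; the left
  quotients are then compared with the right ones.\<close>

lemma has_derivative_at_continuity_point:
  assumes s: "0 < s" and cont: "isCont \<rho> s"
  obtains d where "(w has_vector_derivative d) (at s)" "norm d \<le> \<rho> s"
proof -
  have "cauchy_filter (filtermap (quotient s) (at_right s))"
    unfolding cauchy_filter_metric_filtermap
  proof (intro allI impI)
    fix e :: real assume "e > 0"
    then have "e / 2 > 0" by simp
    from quotients_uniformly_close[OF s cont this] obtain \<eta> where \<eta>: "0 < \<eta>" "\<eta> < s"
      "\<And>r t t'. s - \<eta> \<le> r \<Longrightarrow> r \<le> s \<Longrightarrow> r < t \<Longrightarrow> r < t' \<Longrightarrow> t \<le> s + \<eta> \<Longrightarrow> t' \<le> s + \<eta> \<Longrightarrow>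
        norm (quotient r t - quotient r t') \<le> e / 2" by blast
    have "eventually (\<lambda>y. y \<in> {s<..<s + \<eta>}) (at_right s)"
      using \<eta>(1) by (intro eventually_at_right_real) simp
    moreover have "dist (quotient s x) (quotient s y) < e"
      if "x \<in> {s<..<s + \<eta>}" "y \<in> {s<..<s + \<eta>}" for x y
    proof -
      have "norm (quotient s x - quotient s y) \<le> e / 2"
        using that \<eta>(1) by (intro \<eta>(3)) auto
      then show ?thesis using \<open>e > 0\<close> by (simp add: dist_norm)
    qed
    ultimately show "\<exists>P. eventually P (at_right s) \<and> (\<forall>x y. P x \<and> P y \<longrightarrow> dist (quotient s x) (quotient s y) < e)"
      by blast
  qed
  then have "\<exists>d. filtermap (quotient s) (at_right s) \<le> nhds d"
    by (rule cauchy_filter_complete_converges[OF _ complete_UNIV]) (simp_all add: filtermap_bot_iff)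
  then obtain d where d: "(quotient s \<longlongrightarrow> d) (at_right s)"
    by (auto simp: filterlim_def)
  have ev: "eventually (\<lambda>y. s < y) (at_right s)"
    by (rule eventually_at_right_less)
  have "norm d \<le> \<rho> s"
    by (rule tendsto_upperbound[OF tendsto_norm[OF d]])
       (use ev in \<open>auto elim!: eventually_mono intro: norm_quotient_le[OF s]\<close>)
  moreover have "(w has_vector_derivative d) (at s)"
    unfolding has_vector_derivative_def has_derivative_at_alt
  proof (intro conjI allI impI)
    fix e :: real assume e: "e > 0"
    then have "e / 3 > 0" by simp
    from quotients_uniformly_close[OF s cont this] obtain \<eta> where \<eta>: "0 < \<eta>" "\<eta> < s"
      "\<And>r t t'. s - \<eta> \<le> r \<Longrightarrow> r \<le> s \<Longrightarrow> r < t \<Longrightarrow> r < t' \<Longrightarrow> t \<le> s + \<eta> \<Longrightarrow> t' \<le> s + \<eta> \<Longrightarrow>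
        norm (quotient r t - quotient r t') \<le> e / 3" by blast
    have right: "norm (quotient s y - d) \<le> e / 3" if y: "s < y" "y \<le> s + \<eta>" for y
    proof (rule tendsto_upperbound)
      show "((\<lambda>t. norm (quotient s y - quotient s t)) \<longlongrightarrow> norm (quotient s y - d)) (at_right s)"
        by (intro tendsto_intros d)
      have "eventually (\<lambda>t. t \<in> {s<..<s + \<eta>}) (at_right s)"
        using \<eta>(1) by (intro eventually_at_right_real) simp
      then show "\<forall>\<^sub>F t in at_right s. norm (quotient s y - quotient s t) \<le> e / 3"
        using \<eta> y by (auto elim!: eventually_mono)
    qed simp
    \<comment> \<open>The quotient over \<open>[s - h, s + h]\<close> is the mean of the two quotients on either side of \<open>s\<close>.
      As it is close to the left one, the left and the right one are close to each other.\<close>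
    have left: "norm (quotient (s - h) s - d) \<le> e" if h: "0 < h" "h \<le> \<eta>" for h
    proof -
      have "quotient (s - h) (s + h) = (1/2) *\<^sub>R (quotient (s - h) s + quotient s (s + h))"
        using h by (simp add: quotient_def flip: scaleR_add_right)
      then have "quotient (s - h) s - d
          = 2 *\<^sub>R (quotient (s - h) s - quotient (s - h) (s + h)) + (quotient s (s + h) - d)"
        by (simp add: algebra_simps scaleR_2)
      also have "norm \<dots> \<le> norm (2 *\<^sub>R (quotient (s - h) s - quotient (s - h) (s + h))) + norm (quotient s (s + h) - d)"
        by (rule norm_triangle_ineq)
      also have "\<dots> = 2 * norm (quotient (s - h) s - quotient (s - h) (s + h)) + norm (quotient s (s + h) - d)"
        by simp
      also have "\<dots> \<le> 2 * (e / 3) + e / 3"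
        using h \<eta>(1,2) by (intro add_mono mult_left_mono \<eta>(3) right) auto
      finally show ?thesis by simp
    qed
    have "norm (w y - w s - (y - s) *\<^sub>R d) \<le> e * norm (y - s)" if y: "norm (y - s) < \<eta>" for y
    proof (cases y s rule: linorder_cases)
      case less
      have "(s - y) *\<^sub>R quotient y s = w s - w y" using less by (simp add: quotient_def)
      then have "w y - w s - (y - s) *\<^sub>R d = (s - y) *\<^sub>R (d - quotient (s - (s - y)) s)"
        by (simp add: scaleR_diff_right) (simp add: algebra_simps)
      then have "norm (w y - w s - (y - s) *\<^sub>R d) = (s - y) * norm (quotient (s - (s - y)) s - d)"
        using less by (simp add: norm_minus_commute)
      also have "\<dots> \<le> (s - y) * e" using less y by (intro mult_left_mono left) auto
      finally show ?thesis using less by (simp add: mult.commute)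
    next
      case greater
      have "w y - w s - (y - s) *\<^sub>R d = (y - s) *\<^sub>R (quotient s y - d)"
        using greater by (simp add: quotient_def scaleR_diff_right)
      then have "norm (w y - w s - (y - s) *\<^sub>R d) = (y - s) * norm (quotient s y - d)"
        using greater by simp
      also have "\<dots> \<le> (y - s) * (e / 3)" using greater y by (intro mult_left_mono right) auto
      also have "\<dots> \<le> (y - s) * e" using greater e by (intro mult_left_mono) auto
      finally show ?thesis using greater by (simp add: mult.commute)
    qed simp
    then show "\<exists>d'>0. \<forall>y. norm (y - s) < d' \<longrightarrow> norm (w y - w s - (y - s) *\<^sub>R d) \<le> e * norm (y - s)"
      using \<eta>(1) by blast
  qed (rule bounded_linear_scaleR_left)
  ultimately show thesis using that by blast
qed

text \<open>Test the slope bound at \<open>w s\<close> with a point that lies, for small \<open>k\<close>, on the segment from \<open>w (s + k)\<close> to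
  \<open>v\<close>, at the fraction \<open>c k\<close> of its length. Dividing by \<open>k\<close> and letting \<open>k \<rightarrow> 0\<close> gives
  \<open>\<rho>\<^sup>2 \<le> c (F v - F (w s)) + \<rho> \<parallel>d + c (v - w s)\<parallel>\<close>; to first order in \<open>c\<close>, and because \<open>\<parallel>d\<parallel> \<le> \<rho>\<close>, this is the
  subgradient inequality for \<open>-d\<close>.\<close>

lemma subgradient_at_continuity_point:
  assumes s: "0 < s" and cont: "isCont \<rho> s" and v: "v \<in> D"
    and d: "(w has_vector_derivative d) (at s)" "norm d \<le> \<rho> s"
  shows "F (w s) - inner d (v - w s) \<le> F v"
proof -
  define e where "e = v - w s"
  define k :: "nat \<Rightarrow> real" where "k n = inverse (real (Suc n))" for n
  have k: "k n > 0" for n by (simp add: k_def)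
  have k0: "k \<longlonglongrightarrow> 0" unfolding k_def by (rule LIMSEQ_inverse_real_of_nat)
  have sk: "(\<lambda>n. s + k n) \<longlonglongrightarrow> s" using tendsto_add[OF tendsto_const k0, of s] by simp
  have qlim: "(\<lambda>n. quotient s (s + k n)) \<longlonglongrightarrow> d"
    unfolding quotient_def by (rule tendsto_straddling_quotient[OF d(1)]) (use k sk in auto)
  have \<rho>lim: "(\<lambda>n. \<rho> (s + k n)) \<longlonglongrightarrow> \<rho> s"
    by (rule isCont_tendsto_compose[OF cont sk])
  have key: "0 \<le> (F v - F (w s)) + inner d e + c * ((norm e)\<^sup>2 / 2)" if c: "c > 0" for c
  proof -
    define B where "B n = - (1 - c * k n) * (\<rho> (s + k n))\<^sup>2 + c * (F v - F (w s))
        + \<rho> s * norm ((1 - c * k n) *\<^sub>R quotient s (s + k n) + c *\<^sub>R e)" for n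
    have "0 \<le> B n" if n: "c * k n \<le> 1" for n
    proof -
      define m where "m = c * k n"
      have m: "0 \<le> m" "m \<le> 1" using n c k[of n] by (auto simp: m_def)
      define b where "b = w (s + k n)"
      have b: "b \<in> D" "F b \<le> F (w s) - (\<rho> (s + k n))\<^sup>2 * k n"
        using descent[of s "s + k n"] in_dom[of "s + k n"] s k[of n] by (auto simp: b_def)
      have bw: "b - w s = k n *\<^sub>R quotient s (s + k n)" using k[of n] by (simp add: b_def quotient_def)
      have "F (w s) \<le> F ((1 - m) *\<^sub>R b + m *\<^sub>R v) + \<rho> s * norm ((1 - m) *\<^sub>R b + m *\<^sub>R v - w s)"
        using b v m by (intro slope s convex_dom)
      also have "F ((1 - m) *\<^sub>R b + m *\<^sub>R v) \<le> (1 - m) * F b + m * F v"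
        using b v m by (intro convex)
      also have "(1 - m) * F b \<le> (1 - m) * (F (w s) - (\<rho> (s + k n))\<^sup>2 * k n)"
        using b m by (intro mult_left_mono) auto
      also have "(1 - m) *\<^sub>R b + m *\<^sub>R v - w s = (1 - m) *\<^sub>R (b - w s) + m *\<^sub>R e"
        by (simp add: e_def algebra_simps)
      also have "\<dots> = k n *\<^sub>R ((1 - m) *\<^sub>R quotient s (s + k n) + c *\<^sub>R e)"
        by (simp add: bw m_def algebra_simps)
      also have "norm \<dots> = k n * norm ((1 - m) *\<^sub>R quotient s (s + k n) + c *\<^sub>R e)"
        using k[of n] by simp
      finally have "0 \<le> k n * B n"
        by (simp add: B_def m_def algebra_simps)
      then show ?thesis using k[of n] by (simp add: zero_le_mult_iff)
    qed
    moreover have "\<forall>\<^sub>F n in sequentially. c * k n < 1"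
      using tendsto_mult[OF tendsto_const k0, of c] by (intro order_tendstoD(2)) auto
    ultimately have "\<forall>\<^sub>F n in sequentially. 0 \<le> B n" by (auto elim!: eventually_mono)
    moreover have "B \<longlonglongrightarrow> - (1 - c * 0) * (\<rho> s)\<^sup>2 + c * (F v - F (w s)) + \<rho> s * norm ((1 - c * 0) *\<^sub>R d + c *\<^sub>R e)"
      unfolding B_def by (intro tendsto_intros k0 \<rho>lim qlim)
    ultimately have "0 \<le> - (1 - c * 0) * (\<rho> s)\<^sup>2 + c * (F v - F (w s)) + \<rho> s * norm ((1 - c * 0) *\<^sub>R d + c *\<^sub>R e)"
      using tendsto_lowerbound sequentially_bot by blast
    then have "(\<rho> s)\<^sup>2 \<le> c * (F v - F (w s)) + \<rho> s * norm (d + c *\<^sub>R e)" by simp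
    moreover have "2 * (\<rho> s * norm (d + c *\<^sub>R e)) \<le> (\<rho> s)\<^sup>2 + (norm (d + c *\<^sub>R e))\<^sup>2"
      using sum_squares_bound[of "\<rho> s" "norm (d + c *\<^sub>R e)"] by simp
    moreover have "(norm (d + c *\<^sub>R e))\<^sup>2 = (norm d)\<^sup>2 + 2 * (c * inner d e) + c * (c * (norm e)\<^sup>2)"
      unfolding power2_norm_eq_inner by (simp add: inner_add inner_commute algebra_simps)
    moreover have "(norm d)\<^sup>2 \<le> (\<rho> s)\<^sup>2" using d(2) by (intro power_mono) auto
    ultimately have "0 \<le> c * (F v - F (w s)) + c * inner d e + c * (c * (norm e)\<^sup>2) / 2" by linarith
    also have "\<dots> = c * ((F v - F (w s)) + inner d e + c * ((norm e)\<^sup>2 / 2))"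
      by (simp add: algebra_simps)
    finally have "0 \<le> c * ((F v - F (w s)) + inner d e + c * ((norm e)\<^sup>2 / 2))" .
    then show ?thesis using c by (simp add: zero_le_mult_iff)
  qed
  have "((\<lambda>c. (F v - F (w s)) + inner d e + c * ((norm e)\<^sup>2 / 2)) \<longlongrightarrow> (F v - F (w s)) + inner d e + 0 * ((norm e)\<^sup>2 / 2)) (at_right 0)"
    by (intro tendsto_intros)
  then have "0 \<le> (F v - F (w s)) + inner d e + 0 * ((norm e)\<^sup>2 / 2)"
    by (rule tendsto_lowerbound) (use key in \<open>auto simp: eventually_at_filter intro!: always_eventually\<close>)
  then show ?thesis by (simp add: e_def)
qed

lemma countable_discontinuities: "countable {s \<in> {0<..}. \<not> isCont \<rho> s}"
proof -
  have "mono_on {0<..} (\<lambda>s. - \<rho> s)" by (auto intro!: mono_onI rho_antimono)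
  then have "countable {s \<in> {0<..}. \<not> isCont (\<lambda>s. - \<rho> s) s}"
    by (intro mono_on_ctble_discont_open) auto
  moreover have "isCont (\<lambda>s. - \<rho> s) s \<longleftrightarrow> isCont \<rho> s" for s
    using continuous_minus[of "at s" \<rho>] continuous_minus[of "at s" "\<lambda>s. - \<rho> s"] by auto
  ultimately show ?thesis by simp
qed

lemma locally_Lipschitz:
  assumes "0 < a" "a \<le> x" "a \<le> y"
  shows "norm (w y - w x) \<le> \<rho> a * \<bar>y - x\<bar>"
proof -
  have *: "norm (w y - w x) \<le> \<rho> a * (y - x)" if "a \<le> x" "x < y" for x y
  proof -
    have "norm (w y - w x) \<le> \<rho> x * (y - x)" using that assms(1) by (intro speed) auto
    also have "\<dots> \<le> \<rho> a * (y - x)" using that assms(1) by (intro mult_right_mono rho_antimono) auto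
    finally show ?thesis .
  qed
  show ?thesis
    using *[of x y] *[of y x] assms by (cases x y rule: linorder_cases) (auto simp: norm_minus_commute)
qed

lemma continuous_on_pos: "continuous_on {0<..} w"
proof (rule continuous_on_locally_Lipschitz)
  show "\<exists>L. \<forall>x\<ge>a. \<forall>y\<ge>a. norm (w y - w x) \<le> L * \<bar>y - x\<bar>" if "a > 0" for a
    using locally_Lipschitz[OF that] by blast
qed

lemma H1_loc: "H1_loc w"
proof (rule H1_loc_locally_Lipschitz[OF _ countable_discontinuities])
  show "\<exists>L. \<forall>x\<ge>a. \<forall>y\<ge>a. norm (w y - w x) \<le> L * \<bar>y - x\<bar>" if "a > 0" for a
    using locally_Lipschitz[OF that] by blast
  show "w differentiable (at s)" if "s > 0" "s \<notin> {s \<in> {0<..}. \<not> isCont \<rho> s}" for s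
    using has_derivative_at_continuity_point[of s] that by (auto intro: differentiableI_vector)
qed

end

section \<open>Weighted variation\<close>

definition weighted_variation :: "(real \<Rightarrow> real) \<Rightarrow> (real \<Rightarrow> 'a::real_normed_vector) \<Rightarrow> real \<Rightarrow> real \<Rightarrow> ennreal" where
  "weighted_variation \<kappa> u r t =
     (SUP (N, \<tau>) \<in> partitions r t. ennreal (\<Sum>j<N. \<kappa> (\<tau> j) * norm (u (\<tau> (Suc j)) - u (\<tau> j))))"

lemma variation_eq_weighted_variation: "variation u r t = weighted_variation (\<lambda>_. 1) u r t"
  by (simp add: variation_def weighted_variation_def)

lemma s_hat_eq_weighted_variation: "s_hat u t = enn2real (weighted_variation (\<lambda>x. x) u 0 t)"
  by (simp add: s_hat_def weighted_variation_def)

text \<open>Repeated points contribute nothing, so weakly increasing sequences may be used in place of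
  partitions. This makes it possible to cut partitions at a given point and to concatenate them
  without a case distinction.\<close>

lemma weak_partition_sum_le:
  fixes u :: "real \<Rightarrow> 'a::real_normed_vector"
  assumes mono: "\<And>j. j < N \<Longrightarrow> \<tau> j \<le> \<tau> (Suc j)" and bounds: "r \<le> \<tau> 0" "\<tau> N \<le> t"
  shows "ennreal (\<Sum>j<N. \<kappa> (\<tau> j) * norm (u (\<tau> (Suc j)) - u (\<tau> j))) \<le> weighted_variation \<kappa> u r t"
proof -
  let ?S = "\<lambda>N \<tau>. \<Sum>j<N. \<kappa> (\<tau> j) * norm (u (\<tau> (Suc j)) - u (\<tau> j))"
  have "\<exists>N' \<sigma>. strict_mono_on {..N'} \<sigma> \<and> \<sigma> 0 = \<tau> 0 \<and> \<sigma> N' = \<tau> N \<and> ?S N' \<sigma> = ?S N \<tau>"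
    using mono
  proof (induction N)
    case 0
    show ?case by (rule exI[of _ 0], rule exI[of _ \<tau>]) (auto intro: strict_mono_onI)
  next
    case (Suc N)
    then obtain N' \<sigma> where IH: "strict_mono_on {..N'} \<sigma>" "\<sigma> 0 = \<tau> 0" "\<sigma> N' = \<tau> N" "?S N' \<sigma> = ?S N \<tau>"
      by force
    show ?case
    proof (cases "\<tau> (Suc N) = \<tau> N")
      case True
      with IH show ?thesis by (intro exI[of _ N'] exI[of _ \<sigma>]) auto
    next
      case False
      with Suc.prems[of N] have lt: "\<sigma> N' < \<tau> (Suc N)" by (simp add: IH)
      define \<sigma>' where "\<sigma>' = \<sigma>(Suc N' := \<tau> (Suc N))"
      have "strict_mono_on {..Suc N'} \<sigma>'"
      proof (rule strict_mono_onI)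
        fix i k assume ik: "i \<in> {..Suc N'}" "k \<in> {..Suc N'}" "i < k"
        have "\<sigma> i \<le> \<sigma> N'" if "i \<le> N'"
          using strict_mono_onD[OF IH(1), of i N'] that by (cases "i = N'") auto
        moreover have "\<sigma> i < \<sigma> k" if "k \<le> N'"
          using strict_mono_onD[OF IH(1), of i k] that ik by auto
        ultimately show "\<sigma>' i < \<sigma>' k" using ik lt by (auto simp: \<sigma>'_def le_Suc_eq)
      qed
      moreover have "?S (Suc N') \<sigma>' = ?S N' \<sigma> + \<kappa> (\<sigma> N') * norm (u (\<tau> (Suc N)) - u (\<sigma> N'))"
        by (simp add: \<sigma>'_def)
      moreover have "\<sigma>' 0 = \<sigma> 0" "\<sigma>' (Suc N') = \<tau> (Suc N)" by (simp_all add: \<sigma>'_def)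
      ultimately show ?thesis using IH
        by (intro exI[of _ "Suc N'"] exI[of _ \<sigma>']) auto
    qed
  qed
  then obtain N' \<sigma> where "strict_mono_on {..N'} \<sigma>" "\<sigma> 0 = \<tau> 0" "\<sigma> N' = \<tau> N" and eq: "?S N' \<sigma> = ?S N \<tau>"
    by blast
  then have "(N', \<sigma>) \<in> partitions r t" using bounds by (simp add: partitions_def)
  then have "ennreal (?S N' \<sigma>) \<le> weighted_variation \<kappa> u r t"
    unfolding weighted_variation_def by (auto intro: SUP_upper2)
  then show ?thesis by (simp add: eq)
qed

lemma partitions_mono: "(N, \<tau>) \<in> partitions r t \<Longrightarrow> i \<le> k \<Longrightarrow> k \<le> N \<Longrightarrow> \<tau> i \<le> \<tau> k"
  by (cases "i = k") (auto simp: partitions_def dest!: strict_mono_onD[of _ \<tau> i k])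

lemma partitions_nonempty: "r \<le> t \<Longrightarrow> partitions r t \<noteq> {}"
  by (auto simp: partitions_def intro!: exI[of _ 0] exI[of _ "\<lambda>_. r"] strict_mono_onI)

lemma norm_diff_le_variation:
  assumes "r \<le> t"
  shows "ennreal (norm (u t - u r)) \<le> variation u r t"
  using weak_partition_sum_le[of 1 "\<lambda>i. if i = 0 then r else t" r t "\<lambda>_. 1" u] assms
  by (simp add: variation_eq_weighted_variation)

lemma weighted_variation_trivial: "weighted_variation \<kappa> u t t = 0"
proof -
  have "N = 0" if "(N, \<tau>) \<in> partitions t t" for N \<tau>
    using that by (cases N) (auto simp: partitions_def dest!: strict_mono_onD[of _ \<tau> 0 N])
  then have "weighted_variation \<kappa> u t t \<le> 0"
    unfolding weighted_variation_def by (intro SUP_least) force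
  then show ?thesis by simp
qed

text \<open>Cutting a partition at \<open>r\<close>: the summands are evaluated at \<open>min (\<tau> j) r\<close> and \<open>max (\<tau> j) r\<close>, and the
  only interval that is really divided is handled by the triangle inequality. Its left part keeps
  the weight \<open>\<tau> j\<close>; every weight in the right part is at most \<open>t\<close>.\<close>

lemma weighted_variation_le:
  fixes u :: "real \<Rightarrow> 'a::real_normed_vector"
  assumes rt: "0 \<le> r" "r \<le> t"
  shows "weighted_variation (\<lambda>x. x) u 0 t \<le> weighted_variation (\<lambda>x. x) u 0 r + ennreal t * variation u r t"
  unfolding weighted_variation_def[of _ _ 0 t]
proof (rule SUP_least, clarify)
  fix N \<tau> assume P: "(N, \<tau>) \<in> partitions 0 t"
  have \<tau>: "\<tau> i \<le> \<tau> k" if "i \<le> k" "k \<le> N" for i k using partitions_mono[OF P that] .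
  have \<tau>0: "0 \<le> \<tau> 0" "\<tau> N \<le> t" using P by (auto simp: partitions_def)
  define a b where "a i = min (\<tau> i) r" and "b i = max (\<tau> i) r" for i
  have ab_mono: "a j \<le> a (Suc j)" "b j \<le> b (Suc j)" if "j < N" for j
    using \<tau>[of j "Suc j"] that by (auto simp: a_def b_def)
  have "\<tau> j * norm (u (\<tau> (Suc j)) - u (\<tau> j))
      \<le> a j * norm (u (a (Suc j)) - u (a j)) + t * norm (u (b (Suc j)) - u (b j))" if "j < N" for j
  proof -
    have j: "0 \<le> \<tau> j" "\<tau> j \<le> \<tau> (Suc j)" "\<tau> (Suc j) \<le> t"
      using \<tau>[of 0 j] \<tau>[of j "Suc j"] \<tau>[of "Suc j" N] \<tau>0 that by auto
    consider "\<tau> (Suc j) \<le> r" | "r \<le> \<tau> j" | "\<tau> j < r" "r < \<tau> (Suc j)" by linarith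
    then show ?thesis
    proof cases
      case 3
      have "\<tau> j * norm (u (\<tau> (Suc j)) - u (\<tau> j))
          \<le> \<tau> j * (norm (u r - u (\<tau> j)) + norm (u (\<tau> (Suc j)) - u r))"
        using j norm_triangle_ineq[of "u r - u (\<tau> j)" "u (\<tau> (Suc j)) - u r"]
        by (intro mult_left_mono) auto
      also have "\<dots> \<le> \<tau> j * norm (u r - u (\<tau> j)) + t * norm (u (\<tau> (Suc j)) - u r)"
        unfolding distrib_left using j by (intro add_left_mono mult_right_mono) auto
      finally show ?thesis using 3 by (simp add: a_def b_def)
    qed (use j in \<open>auto simp: a_def b_def intro: mult_right_mono\<close>)
  qed
  then have "(\<Sum>j<N. \<tau> j * norm (u (\<tau> (Suc j)) - u (\<tau> j)))
      \<le> (\<Sum>j<N. a j * norm (u (a (Suc j)) - u (a j)) + t * norm (u (b (Suc j)) - u (b j)))"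
    by (intro sum_mono) auto
  also have "\<dots> = (\<Sum>j<N. a j * norm (u (a (Suc j)) - u (a j))) + t * (\<Sum>j<N. norm (u (b (Suc j)) - u (b j)))"
    by (simp add: sum.distrib sum_distrib_left)
  finally have "ennreal (\<Sum>j<N. \<tau> j * norm (u (\<tau> (Suc j)) - u (\<tau> j)))
      \<le> ennreal ((\<Sum>j<N. a j * norm (u (a (Suc j)) - u (a j))) + t * (\<Sum>j<N. norm (u (b (Suc j)) - u (b j))))"
    by (rule ennreal_leI)
  also have "\<dots> = ennreal (\<Sum>j<N. a j * norm (u (a (Suc j)) - u (a j)))
      + ennreal t * ennreal (\<Sum>j<N. norm (u (b (Suc j)) - u (b j)))"
  proof -
    have "0 \<le> a j" if "j < N" for j using \<tau>[of 0 j] \<tau>0 rt that by (simp add: a_def)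
    then have "0 \<le> (\<Sum>j<N. a j * norm (u (a (Suc j)) - u (a j)))"
      by (intro sum_nonneg mult_nonneg_nonneg) auto
    moreover have "0 \<le> (\<Sum>j<N. norm (u (b (Suc j)) - u (b j)))" by (intro sum_nonneg) auto
    ultimately show ?thesis using rt by (simp add: ennreal_plus ennreal_mult)
  qed
  also have "\<dots> \<le> weighted_variation (\<lambda>x. x) u 0 r + ennreal t * variation u r t"
  proof (intro add_mono mult_left_mono)
    show "ennreal (\<Sum>j<N. a j * norm (u (a (Suc j)) - u (a j))) \<le> weighted_variation (\<lambda>x. x) u 0 r"
      by (rule weak_partition_sum_le) (use ab_mono \<tau>0 rt in \<open>auto simp: a_def min_le_iff_disj\<close>)
    show "ennreal (\<Sum>j<N. norm (u (b (Suc j)) - u (b j))) \<le> variation u r t"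
      using weak_partition_sum_le[of N b r t "\<lambda>_. 1" u, OF ab_mono(2)] \<tau>0 rt
      by (simp add: b_def le_max_iff_disj variation_eq_weighted_variation)
  qed simp
  finally show "ennreal (\<Sum>j<N. \<tau> j * norm (u (\<tau> (Suc j)) - u (\<tau> j)))
      \<le> weighted_variation (\<lambda>x. x) u 0 r + ennreal t * variation u r t" .
qed

text \<open>Concatenation of a partition of \<open>[0,r]\<close> with one of \<open>[r,t]\<close>, where all weights are at least \<open>r\<close>.\<close>

lemma weighted_variation_ge:
  fixes u :: "real \<Rightarrow> 'a::real_normed_vector"
  assumes rt: "0 \<le> r" "r \<le> t"
  shows "weighted_variation (\<lambda>x. x) u 0 r + ennreal r * variation u r t \<le> weighted_variation (\<lambda>x. x) u 0 t"
proof -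
  have *: "ennreal (\<Sum>j<N. \<tau> j * norm (u (\<tau> (Suc j)) - u (\<tau> j))) + ennreal r * ennreal (\<Sum>j<M. norm (u (\<sigma> (Suc j)) - u (\<sigma> j)))
      \<le> weighted_variation (\<lambda>x. x) u 0 t"
    if P: "(N, \<tau>) \<in> partitions 0 r" and Q: "(M, \<sigma>) \<in> partitions r t" for N \<tau> M \<sigma>
  proof -
    have \<tau>: "\<tau> i \<le> \<tau> k" if "i \<le> k" "k \<le> N" for i k using partitions_mono[OF P that] .
    have \<sigma>: "\<sigma> i \<le> \<sigma> k" if "i \<le> k" "k \<le> M" for i k using partitions_mono[OF Q that] .
    have \<tau>0: "0 \<le> \<tau> 0" "\<tau> N \<le> r" and \<sigma>0: "r \<le> \<sigma> 0" "\<sigma> M \<le> t" using P Q by (auto simp: partitions_def)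
    define c where "c i = (if i \<le> N then \<tau> i else \<sigma> (i - Suc N))" for i
    let ?f = "\<lambda>j. c j * norm (u (c (Suc j)) - u (c j))"
    have c_mono: "c j \<le> c (Suc j)" if "j < N + Suc M" for j
      using \<tau>[of j "Suc j"] \<sigma>[of "j - Suc N" "Suc j - Suc N"] \<tau>0 \<sigma>0 that
      by (cases "j < N"; cases "j = N") (auto simp: c_def Suc_diff_le)
    have \<tau>_nonneg: "0 \<le> \<tau> j" if "j \<le> N" for j using \<tau>[of 0 j] \<tau>0 that by simp
    have \<sigma>_ge: "r \<le> \<sigma> j" if "j \<le> M" for j using \<sigma>[of 0 j] \<sigma>0 that by simp
    have "(\<Sum>j<N. \<tau> j * norm (u (\<tau> (Suc j)) - u (\<tau> j))) + r * (\<Sum>j<M. norm (u (\<sigma> (Suc j)) - u (\<sigma> j)))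
        \<le> (\<Sum>j<N. ?f j) + (\<Sum>j<M. ?f (Suc N + j))"
      unfolding sum_distrib_left using \<sigma>_ge
      by (intro add_mono sum_mono) (auto simp: c_def intro!: mult_right_mono)
    also have "(\<Sum>j<M. ?f (Suc N + j)) = (\<Sum>j\<in>{Suc N..<Suc N + M}. ?f j)"
      using sum.shift_bounds_nat_ivl[of ?f 0 "Suc N" M] by (simp add: atLeast0LessThan add.commute)
    also have "(\<Sum>j<N. ?f j) + (\<Sum>j\<in>{Suc N..<Suc N + M}. ?f j) = (\<Sum>j\<in>{..<N} \<union> {Suc N..<Suc N + M}. ?f j)"
      by (rule sum.union_disjoint[symmetric]) auto
    also have "\<dots> \<le> (\<Sum>j<N + Suc M. ?f j)"
      using \<tau>_nonneg \<sigma>_ge rt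
      by (intro sum_mono2) (auto simp: c_def intro!: mult_nonneg_nonneg order_trans[OF rt(1)])
    finally have "ennreal ((\<Sum>j<N. \<tau> j * norm (u (\<tau> (Suc j)) - u (\<tau> j))) + r * (\<Sum>j<M. norm (u (\<sigma> (Suc j)) - u (\<sigma> j))))
        \<le> ennreal (\<Sum>j<N + Suc M. ?f j)" by (rule ennreal_leI)
    also have "\<dots> \<le> weighted_variation (\<lambda>x. x) u 0 t"
      by (rule weak_partition_sum_le[where \<tau>=c, OF c_mono]) (use \<tau>0 \<sigma>0 in \<open>auto simp: c_def\<close>)
    finally have "ennreal ((\<Sum>j<N. \<tau> j * norm (u (\<tau> (Suc j)) - u (\<tau> j))) + r * (\<Sum>j<M. norm (u (\<sigma> (Suc j)) - u (\<sigma> j))))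
        \<le> weighted_variation (\<lambda>x. x) u 0 t" .
    moreover have "0 \<le> (\<Sum>j<N. \<tau> j * norm (u (\<tau> (Suc j)) - u (\<tau> j)))"
      using \<tau>_nonneg by (intro sum_nonneg mult_nonneg_nonneg) auto
    moreover have "0 \<le> (\<Sum>j<M. norm (u (\<sigma> (Suc j)) - u (\<sigma> j)))" by (intro sum_nonneg) auto
    ultimately show ?thesis using rt by (simp add: ennreal_plus ennreal_mult)
  qed
  have "weighted_variation (\<lambda>x. x) u 0 r + ennreal r * ennreal (\<Sum>j<M. norm (u (\<sigma> (Suc j)) - u (\<sigma> j)))
      \<le> weighted_variation (\<lambda>x. x) u 0 t" if Q: "(M, \<sigma>) \<in> partitions r t" for M \<sigma>
    unfolding weighted_variation_def[of _ _ 0 r] ennreal_SUP_add_left[OF partitions_nonempty[OF rt(1)], symmetric]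
    by (rule SUP_least) (use *[OF _ Q] in auto)
  then show ?thesis
    unfolding variation_def SUP_mult_left_ennreal ennreal_SUP_add_right[OF partitions_nonempty[OF rt(2)]]
    by (intro SUP_least) (auto split: prod.splits)
qed

section \<open>Energetic solutions\<close>

locale energetic =
  fixes J :: "'a::{real_inner, complete_space} \<Rightarrow> ennreal" and u :: "real \<Rightarrow> 'a"
  assumes J_convex: "convex_functional J"
    and J_lsc: "lower_semicontinuous J"
    and J_homogeneous: "positively_homogeneous J"
    and sol: "energetic_solution J u"
begin

definition D :: "'a set" where "D = effective_domain J"
definition F :: "'a \<Rightarrow> real" where "F x = enn2real (J x)"
definition S :: "real \<Rightarrow> real" where "S = s_hat u"

lemma J_eq: "x \<in> D \<Longrightarrow> J x = ennreal (F x)"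
  by (simp add: D_def F_def effective_domain_def)

lemma in_D_iff: "x \<in> D \<longleftrightarrow> J x < \<infinity>"
  by (simp add: D_def effective_domain_def)

lemma F_nonneg: "0 \<le> F x" by (simp add: F_def)

lemma F_convex:
  assumes "x \<in> D" "y \<in> D" "0 \<le> c" "c \<le> 1"
  shows "(1 - c) *\<^sub>R x + c *\<^sub>R y \<in> D" "F ((1 - c) *\<^sub>R x + c *\<^sub>R y) \<le> (1 - c) * F x + c * F y"
proof -
  have "J ((1 - c) *\<^sub>R x + c *\<^sub>R y) \<le> ennreal (1 - c) * J x + ennreal c * J y"
    using J_convex assms by (auto simp: convex_functional_def)
  also have "\<dots> = ennreal ((1 - c) * F x + c * F y)"
    using assms by (simp add: J_eq F_nonneg ennreal_mult ennreal_plus)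
  finally have *: "J ((1 - c) *\<^sub>R x + c *\<^sub>R y) \<le> ennreal ((1 - c) * F x + c * F y)" .
  then show "(1 - c) *\<^sub>R x + c *\<^sub>R y \<in> D"
    by (auto simp: in_D_iff intro: le_less_trans)
  show "F ((1 - c) *\<^sub>R x + c *\<^sub>R y) \<le> (1 - c) * F x + c * F y"
    unfolding F_def[of "_ + _"] using assms F_nonneg * by (intro enn2real_leI) auto
qed

text \<open>\<open>Liminf\<close> at \<open>l\<close> ignores the point \<open>l\<close> itself, so the value \<open>J l\<close> has to be added when passing to
  arbitrary limits.\<close>

lemma eventually_J_greater:
  assumes "c < J l" "(X \<longlongrightarrow> l) G"
  shows "\<forall>\<^sub>F i in G. c < J (X i)"
proof -
  have "c < Liminf (at l) J"
    using J_lsc assms(1) by (auto simp: lower_semicontinuous_def intro: less_le_trans)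
  then have "\<forall>\<^sub>F x in at l. c < J x" by (rule less_LiminfD)
  with assms(1) have "\<forall>\<^sub>F x in nhds l. c < J x"
    by (auto simp: eventually_at_filter elim: eventually_mono)
  then show ?thesis using assms(2) by (auto simp: filterlim_iff)
qed

lemma F_lsc_limit:
  assumes G: "G \<noteq> bot" and X: "(X \<longlongrightarrow> l) G" and c: "(c \<longlongrightarrow> k) G"
    and le: "\<forall>\<^sub>F i in G. X i \<in> D \<and> F (X i) \<le> c i"
  shows "l \<in> D" "F l \<le> k"
proof -
  have k: "0 \<le> k"
    by (rule tendsto_lowerbound[OF c _ G]) (use le F_nonneg in \<open>auto elim!: eventually_mono intro: order_trans\<close>)
  have *: "J l \<le> ennreal k"
  proof (rule ccontr)
    assume "\<not> J l \<le> ennreal k"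
    then obtain m where m: "ennreal k < m" "m < J l" by (meson dense not_le)
    then obtain r where r: "m = ennreal r" "0 \<le> r" by (cases m) auto
    have "k < r" using m(1) k r by (simp add: ennreal_less_iff)
    then have "\<forall>\<^sub>F i in G. c i < r" using c by (rule order_tendstoD(2)[rotated])
    moreover have "\<forall>\<^sub>F i in G. m < J (X i)" by (rule eventually_J_greater[OF m(2) X])
    ultimately have "\<forall>\<^sub>F i in G. False"
      using le
    proof eventually_elim
      case (elim i)
      then have "ennreal r < ennreal (F (X i))" by (simp add: J_eq r)
      with elim show ?case by (simp add: ennreal_less_iff r)
    qed
    then show False using G by simp
  qed
  then show "l \<in> D" by (auto simp: in_D_iff intro: le_less_trans)
  show "F l \<le> k" unfolding F_def using k * by (rule enn2real_leI)
qed

definition stable :: "real \<Rightarrow> 'a \<Rightarrow> bool" where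
  "stable t x \<longleftrightarrow> x \<in> D \<and> (\<forall>v\<in>D. F x \<le> F v + norm (v - x) / t)"

definition V :: "real \<Rightarrow> real \<Rightarrow> real" where "V r t = enn2real (variation u r t)"
definition I :: "real \<Rightarrow> real \<Rightarrow> real" where
  "I r t = enn2real (\<integral>\<^sup>+\<tau>\<in>{r..t}. J (u \<tau>) \<partial>lebesgue)"

lemma energy_balance:
  "0 \<le> r \<Longrightarrow> r < t \<Longrightarrow> ennreal t * J (u t) + variation u r t
     = ennreal r * J (u r) + (\<integral>\<^sup>+\<tau>\<in>{r..t}. J (u \<tau>) \<partial>lebesgue)"
  using sol unfolding energetic_solution_def by blast

lemma integral_finite: "0 \<le> r \<Longrightarrow> r \<le> t \<Longrightarrow> (\<integral>\<^sup>+\<tau>\<in>{r..t}. J (u \<tau>) \<partial>lebesgue) < \<infinity>"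
proof -
  assume "0 \<le> r" "r \<le> t"
  then have "(\<integral>\<^sup>+\<tau>\<in>{r..t}. J (u \<tau>) \<partial>lebesgue) \<le> (\<integral>\<^sup>+\<tau>\<in>{0..t}. J (u \<tau>) \<partial>lebesgue)"
    by (intro nn_integral_mono) (auto simp: indicator_def)
  also have "\<dots> < \<infinity>" using sol \<open>0 \<le> r\<close> \<open>r \<le> t\<close> by (auto simp: energetic_solution_def)
  finally show ?thesis .
qed

lemma u_in_D: "0 < t \<Longrightarrow> u t \<in> D"
proof -
  assume t: "0 < t"
  have "ennreal t * J (u t) \<le> ennreal t * J (u t) + variation u 0 t" by simp
  also have "\<dots> < \<infinity>" using energy_balance[of 0 t] integral_finite[of 0 t] t by simp
  finally show ?thesis using t by (auto simp: in_D_iff ennreal_mult_less_top)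
qed

lemma variation_finite: "0 \<le> r \<Longrightarrow> r < t \<Longrightarrow> variation u r t < \<infinity>"
proof -
  assume rt: "0 \<le> r" "r < t"
  have "variation u r t \<le> ennreal t * J (u t) + variation u r t" by simp
  also have "\<dots> = ennreal r * J (u r) + (\<integral>\<^sup>+\<tau>\<in>{r..t}. J (u \<tau>) \<partial>lebesgue)" using rt by (rule energy_balance)
  also have "\<dots> < \<infinity>"
    using integral_finite[of r t] rt u_in_D[of r] by (cases "r = 0") (auto simp: ennreal_mult_less_top in_D_iff)
  finally show ?thesis .
qed

lemma energy_balance_real:
  assumes "0 \<le> r" "r < t"
  shows "t * F (u t) + V r t = r * F (u r) + I r t"
proof -
  have fin: "ennreal r * J (u r) < \<infinity>" "ennreal t * J (u t) < \<infinity>"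
    using u_in_D[of r] u_in_D[of t] assms by (cases "r = 0"; auto simp: ennreal_mult_less_top in_D_iff)+
  have "enn2real (ennreal t * J (u t) + variation u r t)
      = enn2real (ennreal r * J (u r) + (\<integral>\<^sup>+\<tau>\<in>{r..t}. J (u \<tau>) \<partial>lebesgue))"
    using energy_balance[OF assms] by simp
  then show ?thesis
    using fin variation_finite[OF assms] integral_finite[of r t] assms
    by (simp add: enn2real_plus enn2real_mult V_def I_def F_def)
qed

lemma I_upper:
  assumes "0 < r" "r \<le> t" "0 \<le> M" "\<And>\<tau>. r \<le> \<tau> \<Longrightarrow> \<tau> \<le> t \<Longrightarrow> F (u \<tau>) \<le> M"
  shows "I r t \<le> M * (t - r)"
  unfolding I_def
proof (rule enn2real_leI)
  have "(\<integral>\<^sup>+\<tau>\<in>{r..t}. J (u \<tau>) \<partial>lebesgue) \<le> (\<integral>\<^sup>+\<tau>. ennreal M * indicator {r..t} \<tau> \<partial>lebesgue)"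
    using assms by (intro nn_integral_mono) (auto simp: indicator_def J_eq u_in_D intro!: ennreal_leI)
  also have "\<dots> = ennreal (M * (t - r))"
    using assms by (simp add: nn_integral_cmult_indicator ennreal_mult)
  finally show "(\<integral>\<^sup>+\<tau>\<in>{r..t}. J (u \<tau>) \<partial>lebesgue) \<le> ennreal (M * (t - r))" .
qed (use assms in simp)

lemma I_lower:
  assumes "0 < r" "r \<le> t" "0 \<le> m" "\<And>\<tau>. r \<le> \<tau> \<Longrightarrow> \<tau> \<le> t \<Longrightarrow> m \<le> F (u \<tau>)"
  shows "m * (t - r) \<le> I r t"
proof -
  have "ennreal (m * (t - r)) = (\<integral>\<^sup>+\<tau>. ennreal m * indicator {r..t} \<tau> \<partial>lebesgue)"
    using assms by (simp add: nn_integral_cmult_indicator ennreal_mult)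
  also have "\<dots> \<le> (\<integral>\<^sup>+\<tau>\<in>{r..t}. J (u \<tau>) \<partial>lebesgue)"
    using assms by (intro nn_integral_mono) (auto simp: indicator_def J_eq u_in_D intro!: ennreal_leI)
  also have "\<dots> = ennreal (I r t)" using integral_finite[of r t] assms by (simp add: I_def)
  finally show ?thesis by (simp add: I_def)
qed

lemma I_mono:
  assumes "0 \<le> t" "t \<le> T"
  shows "I 0 t \<le> I 0 T"
  unfolding I_def using assms integral_finite[of 0 T]
  by (intro enn2real_mono nn_integral_mono) (auto simp: indicator_def)

text \<open>The energy balance bounds \<open>t F(u(t))\<close> by \<open>r F(u(r))\<close> plus \<open>t - r\<close> times the supremum \<open>M\<close> of the energy on
  \<open>[r,T]\<close>. So every value is at most a convex combination of \<open>M\<close> and \<open>F(u(r))\<close> in which \<open>F(u(r))\<close> has weight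
  at least \<open>r / T > 0\<close>. Taking the supremum of the values gives \<open>M \<le> F(u(r))\<close>.\<close>

lemma F_u_antimono:
  assumes r: "0 < r" "r \<le> T"
  shows "F (u T) \<le> F (u r)"
proof -
  have T: "0 < T" using r by simp
  let ?A = "(\<lambda>\<tau>. F (u \<tau>)) ` {r..T}"
  have "F (u \<tau>) \<le> I 0 T / r" if \<tau>: "\<tau> \<in> {r..T}" for \<tau>
  proof -
    have "r * F (u \<tau>) \<le> \<tau> * F (u \<tau>)" using \<tau> r by (intro mult_right_mono F_nonneg) auto
    also have "\<dots> \<le> \<tau> * F (u \<tau>) + V 0 \<tau>" by (simp add: V_def)
    also have "\<dots> = I 0 \<tau>" using energy_balance_real[of 0 \<tau>] \<tau> r by simp
    also have "\<dots> \<le> I 0 T" using \<tau> r by (intro I_mono) auto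
    finally show ?thesis using r by (simp add: field_simps)
  qed
  then have bdd: "bdd_above ?A" by (rule bdd_aboveI2)
  define M where "M = Sup ?A"
  have M: "F (u \<tau>) \<le> M" if "\<tau> \<in> {r..T}" for \<tau> unfolding M_def using bdd that by (intro cSup_upper) auto
  have M0: "0 \<le> M" using M[of r] F_nonneg[of "u r"] r by simp
  have "F (u t) \<le> M - (r / T) * (M - F (u r))" if t: "t \<in> {r..T}" for t
  proof (cases "t = r")
    case True
    have "(r / T) * (M - F (u r)) \<le> 1 * (M - F (u r))"
      using r M[of r] by (intro mult_right_mono) auto
    then show ?thesis using True by simp
  next
    case False
    have "t * F (u t) \<le> t * F (u t) + V r t" by (simp add: V_def)
    also have "\<dots> = r * F (u r) + I r t" using t r False by (intro energy_balance_real) auto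
    also have "\<dots> \<le> r * F (u r) + M * (t - r)" using t r M0 M by (intro add_left_mono I_upper) auto
    also have "\<dots> = t * (M - (r / t) * (M - F (u r)))" using t r by (simp add: field_simps)
    finally have "t * F (u t) \<le> t * (M - (r / t) * (M - F (u r)))" .
    then have "F (u t) \<le> M - (r / t) * (M - F (u r))" using t r by simp
    also have "\<dots> \<le> M - (r / T) * (M - F (u r))"
      using t r M[of r] by (intro diff_left_mono mult_right_mono divide_left_mono) auto
    finally show ?thesis .
  qed
  then have "M \<le> M - (r / T) * (M - F (u r))"
    unfolding M_def using r by (intro cSup_least) auto
  then have "M \<le> F (u r)" using r T by (simp add: mult_le_0_iff divide_le_0_iff)
  then show ?thesis using M[of T] r by simp
qed

text \<open>The two sides of \<open>t dF = -\<parallel>du\<parallel>\<close>: monotonicity encloses the integral in the energy balance between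
  \<open>(t - r) F(u(t))\<close> and \<open>(t - r) F(u(r))\<close>.\<close>

lemma variation_energy_bounds:
  assumes "0 < r" "r < t"
  shows "V r t \<le> t * (F (u r) - F (u t))" "r * (F (u r) - F (u t)) \<le> V r t"
proof -
  have "I r t \<le> F (u r) * (t - r)"
    using assms by (intro I_upper F_nonneg F_u_antimono) auto
  moreover have "F (u t) * (t - r) \<le> I r t"
    using assms by (intro I_lower F_nonneg F_u_antimono) auto
  ultimately show "V r t \<le> t * (F (u r) - F (u t))" "r * (F (u r) - F (u t)) \<le> V r t"
    using energy_balance_real[of r t] assms by (simp_all add: algebra_simps)
qed

lemma weighted_variation_finite: "0 \<le> t \<Longrightarrow> weighted_variation (\<lambda>x. x) u 0 t < \<infinity>"
  using weighted_variation_le[of 0 t u] variation_finite[of 0 t]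
  by (cases "t = 0") (auto simp: weighted_variation_trivial ennreal_mult_less_top intro: le_less_trans)

lemma S_bounds:
  assumes "0 \<le> r" "r < t"
  shows "S t \<le> S r + t * V r t" "S r + r * V r t \<le> S t"
proof -
  note fin = weighted_variation_finite[of r] weighted_variation_finite[of t] variation_finite[OF assms]
  have "weighted_variation (\<lambda>x. x) u 0 t \<le> weighted_variation (\<lambda>x. x) u 0 r + ennreal t * variation u r t"
    using assms by (intro weighted_variation_le) auto
  then have "S t \<le> enn2real (weighted_variation (\<lambda>x. x) u 0 r + ennreal t * variation u r t)"
    unfolding S_def s_hat_eq_weighted_variation using fin assms
    by (intro enn2real_mono) (auto simp: ennreal_mult_less_top)
  then show "S t \<le> S r + t * V r t"
    unfolding S_def s_hat_eq_weighted_variation V_def using fin assms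
    by (simp add: enn2real_plus enn2real_mult ennreal_mult_less_top)
  have "weighted_variation (\<lambda>x. x) u 0 r + ennreal r * variation u r t \<le> weighted_variation (\<lambda>x. x) u 0 t"
    using assms by (intro weighted_variation_ge) auto
  then have "enn2real (weighted_variation (\<lambda>x. x) u 0 r + ennreal r * variation u r t) \<le> S t"
    unfolding S_def s_hat_eq_weighted_variation using fin assms
    by (intro enn2real_mono) auto
  then show "S r + r * V r t \<le> S t"
    unfolding S_def s_hat_eq_weighted_variation V_def using fin assms
    by (simp add: enn2real_plus enn2real_mult ennreal_mult_less_top)
qed

lemma S_0: "S 0 = 0"
  by (simp add: S_def s_hat_eq_weighted_variation weighted_variation_trivial)

lemma S_mono: "0 \<le> r \<Longrightarrow> r \<le> t \<Longrightarrow> S r \<le> S t"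
  using S_bounds(2)[of r t] by (cases "r = t") (auto simp: V_def intro: order_trans[rotated])

lemma S_small: "0 < t \<Longrightarrow> t \<le> 1 \<Longrightarrow> S t \<le> t * I 0 1"
proof -
  assume t: "0 < t" "t \<le> 1"
  have "S t \<le> t * V 0 t" using S_bounds(1)[of 0 t] t S_0 by simp
  also have "V 0 t \<le> I 0 t" using energy_balance_real[of 0 t] t F_nonneg[of "u t"] by (smt (verit) mult_nonneg_nonneg mult_zero_left)
  also have "I 0 t \<le> I 0 1" using t by (intro I_mono) auto
  finally show ?thesis using t by (simp add: mult_left_mono)
qed

lemma stable_u:
  assumes t: "0 < t"
  shows "stable t (u t)"
  unfolding stable_def
proof (intro conjI ballI u_in_D t)
  fix v assume v: "v \<in> D"
  have "ennreal t * J (u t) \<le> ennreal t * J v + ennreal (norm (v - u t))"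
    using sol t by (auto simp: energetic_solution_def stable_at_def)
  then have "ennreal (t * F (u t)) \<le> ennreal (t * F v + norm (v - u t))"
    using v u_in_D[OF t] t by (simp add: J_eq F_nonneg ennreal_mult ennreal_plus)
  then have "t * F (u t) \<le> t * F v + norm (v - u t)"
    using t F_nonneg by (subst (asm) ennreal_le_iff) auto
  then show "F (u t) \<le> F v + norm (v - u t) / t" using t by (simp add: field_simps)
qed

lemma norm_u_diff_le:
  assumes "0 < r" "r < t"
  shows "norm (u t - u r) \<le> V r t"
proof -
  have "enn2real (ennreal (norm (u t - u r))) \<le> V r t"
    unfolding V_def using assms variation_finite[of r t]
    by (intro enn2real_mono norm_diff_le_variation) auto
  then show ?thesis by simp
qed

text \<open>A state consists of a time \<open>t\<close>, the value \<open>s\<close> of the new parameter and a position \<open>x\<close>. The rates at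
  which the distance grows and the energy drops with \<open>s\<close> are taken at the earlier and at the later
  time, respectively; this choice makes the relation transitive.\<close>

definition step :: "real \<Rightarrow> real \<Rightarrow> 'a \<Rightarrow> real \<Rightarrow> real \<Rightarrow> 'a \<Rightarrow> bool" where
  "step t s x t' s' x' \<longleftrightarrow> t \<le> t' \<and> s \<le> s' \<and>
     norm (x' - x) \<le> (s' - s) / t \<and> F x' \<le> F x - (s' - s) / t'\<^sup>2"

lemma step_u:
  assumes rt: "0 < r" "r < t"
  shows "step r (S r) (u r) t (S t) (u t)"
  unfolding step_def
proof (intro conjI)
  have S: "S t \<le> S r + t * V r t" "S r + r * V r t \<le> S t" using S_bounds[of r t] rt by auto
  have "norm (u t - u r) \<le> V r t" by (rule norm_u_diff_le[OF rt])
  also have "V r t \<le> (S t - S r) / r" using S rt by (simp add: field_simps)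
  finally show "norm (u t - u r) \<le> (S t - S r) / r" .
  have "(S t - S r) / t\<^sup>2 \<le> (t * V r t) / t\<^sup>2" using S rt by (intro divide_right_mono) auto
  also have "\<dots> = V r t / t" using rt by (simp add: power2_eq_square)
  also have "\<dots> \<le> F (u r) - F (u t)" using variation_energy_bounds(1)[OF rt] rt by (simp add: field_simps)
  finally show "F (u t) \<le> F (u r) - (S t - S r) / t\<^sup>2" by simp
qed (use rt S_mono[of r t] in auto)

end

section \<open>Convergence along filters\<close>

lemma convergent_filter_of_Cauchy_bound:
  fixes f :: "real \<Rightarrow> 'a::{real_normed_vector, complete_space}" and g :: "real \<Rightarrow> real"
  assumes G: "G \<noteq> bot" and g: "(g \<longlongrightarrow> l) G" and P: "eventually P G" and C: "0 < C"
    and le: "\<And>x y. P x \<Longrightarrow> P y \<Longrightarrow> x < y \<Longrightarrow> norm (f y - f x) \<le> C * \<bar>g y - g x\<bar>"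
  shows "\<exists>x. (f \<longlongrightarrow> x) G"
proof -
  have le': "dist (f x) (f y) \<le> C * dist (g x) (g y)" if "P x" "P y" for x y
    using le[of x y] le[of y x] that
    by (cases x y rule: linorder_cases) (auto simp: dist_norm norm_minus_commute abs_minus_commute)
  have "cauchy_filter (filtermap f G)"
    unfolding cauchy_filter_metric_filtermap
  proof (intro allI impI)
    fix e :: real assume e: "e > 0"
    then have "\<forall>\<^sub>F x in G. dist (g x) l < e / C / 2" using g C by (intro tendstoD) auto
    with P have "\<forall>\<^sub>F x in G. P x \<and> dist (g x) l < e / C / 2" by eventually_elim simp
    moreover have "dist (f x) (f y) < e"
      if "P x \<and> dist (g x) l < e / C / 2" "P y \<and> dist (g y) l < e / C / 2" for x y
    proof -
      have "dist (g x) (g y) < e / C"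
        by (rule dist_triangle_half_l[of _ l]) (use that in auto)
      then have "C * dist (g x) (g y) < e" using C by (simp add: field_simps)
      then show ?thesis using le'[of x y] that by simp
    qed
    ultimately show "\<exists>P. eventually P G \<and> (\<forall>x y. P x \<and> P y \<longrightarrow> dist (f x) (f y) < e)" by blast
  qed
  then have "\<exists>x. filtermap f G \<le> nhds x"
    by (rule cauchy_filter_complete_converges[OF _ complete_UNIV]) (simp_all add: filtermap_bot_iff G)
  then show ?thesis by (simp add: filterlim_def)
qed

lemma filterlim_minus_at_left: "filterlim (\<lambda>h. t - h) (at_left t) (at_right (0::real))"
  unfolding filterlim_at
  by (auto intro!: tendsto_eq_intros simp: eventually_at_filter)

lemma filterlim_plus_at_right: "filterlim (\<lambda>h. t + h) (at_right t) (at_right (0::real))"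
  unfolding filterlim_at
  by (auto intro!: tendsto_eq_intros simp: eventually_at_filter)

section \<open>One-sided limits and jumps\<close>

context energetic
begin

text \<open>Lower semicontinuity bounds the energy of the limit from above; stability of the approximating
  states, tested with the limit \<open>x\<close>, excludes that energy is lost.\<close>

lemma stable_limit:
  assumes G: "G \<noteq> bot" and T: "(T \<longlongrightarrow> t) G" "0 < t" and X: "(X \<longlongrightarrow> x) G"
    and stab: "\<forall>\<^sub>F i in G. stable (T i) (X i)"
  shows "stable t x" "((\<lambda>i. F (X i)) \<longlongrightarrow> F x) G"
proof -
  have *: "x \<in> D \<and> F x \<le> F v + norm (v - x) / t" if v: "v \<in> D" for v
  proof -
    have "\<forall>\<^sub>F i in G. X i \<in> D \<and> F (X i) \<le> F v + norm (v - X i) / T i"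
      using stab by eventually_elim (use v in \<open>auto simp: stable_def\<close>)
    moreover have "((\<lambda>i. F v + norm (v - X i) / T i) \<longlongrightarrow> F v + norm (v - x) / t) G"
      using T by (intro tendsto_intros X) auto
    ultimately show ?thesis using F_lsc_limit[OF G X] by blast
  qed
  show st: "stable t x" using * u_in_D[of 1] by (auto simp: stable_def)
  show "((\<lambda>i. F (X i)) \<longlongrightarrow> F x) G"
  proof (rule order_tendstoI)
    fix a assume a: "a < F x"
    show "\<forall>\<^sub>F i in G. a < F (X i)"
    proof (cases "a < 0")
      case True
      then show ?thesis using F_nonneg by (auto intro!: always_eventually intro: less_le_trans)
    next
      case False
      have "J x = ennreal (F x)" using st by (intro J_eq) (simp add: stable_def)
      then have "ennreal a < J x" using a False by (simp add: ennreal_less_iff)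
      from eventually_J_greater[OF this X] stab show ?thesis
      proof eventually_elim
        case (elim i)
        then have "ennreal a < ennreal (F (X i))" by (simp add: stable_def J_eq)
        then show ?case using False by (simp add: ennreal_less_iff)
      qed
    qed
  next
    fix a assume a: "F x < a"
    have "((\<lambda>i. F x + norm (x - X i) / T i) \<longlongrightarrow> F x + norm (x - x) / t) G"
      using T by (intro tendsto_intros X) auto
    then have "\<forall>\<^sub>F i in G. F x + norm (x - X i) / T i < a" using a by (intro order_tendstoD) auto
    with stab show "\<forall>\<^sub>F i in G. F (X i) < a"
    proof eventually_elim
      case (elim i)
      then have "F (X i) \<le> F x + norm (x - X i) / T i" using st by (auto simp: stable_def)
      then show ?case using elim by simp
    qed
  qed
qed

text \<open>One parameter \<open>h\<close> drives both times, so that the same lemma covers one-sided limits at either end,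
  at both ends, and at a single time from its two sides.\<close>

lemma step_limit:
  assumes G: "G \<noteq> bot"
    and A: "(A \<longlongrightarrow> a) G" "0 < a" "((\<lambda>h. S (A h)) \<longlongrightarrow> s) G" "((\<lambda>h. u (A h)) \<longlongrightarrow> x) G"
    and B: "(B \<longlongrightarrow> b) G" "0 < b" "((\<lambda>h. S (B h)) \<longlongrightarrow> s') G" "((\<lambda>h. u (B h)) \<longlongrightarrow> y) G"
    and AB: "\<forall>\<^sub>F h in G. 0 < A h \<and> A h < B h"
  shows "stable a x" "stable b y" "step a s x b s' y"
proof -
  have "\<forall>\<^sub>F h in G. stable (A h) (u (A h))" "\<forall>\<^sub>F h in G. stable (B h) (u (B h))"
    using AB by (auto elim!: eventually_mono intro!: stable_u)
  note stabA = stable_limit[OF G A(1,2,4) this(1)] and stabB = stable_limit[OF G B(1,2,4) this(2)]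
  have st: "\<forall>\<^sub>F h in G. step (A h) (S (A h)) (u (A h)) (B h) (S (B h)) (u (B h))"
    using AB by eventually_elim (rule step_u, auto)
  show "step a s x b s' y"
    unfolding step_def
  proof (intro conjI)
    show "a \<le> b" by (rule tendsto_le[OF G B(1) A(1)]) (use st in \<open>auto elim!: eventually_mono simp: step_def\<close>)
    show "s \<le> s'" by (rule tendsto_le[OF G B(3) A(3)]) (use st in \<open>auto elim!: eventually_mono simp: step_def\<close>)
    show "norm (y - x) \<le> (s' - s) / a"
    proof (rule tendsto_le[OF G])
      show "((\<lambda>h. (S (B h) - S (A h)) / A h) \<longlongrightarrow> (s' - s) / a) G"
        using A B by (intro tendsto_intros) auto
      show "((\<lambda>h. norm (u (B h) - u (A h))) \<longlongrightarrow> norm (y - x)) G"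
        using A B by (intro tendsto_intros) auto
    qed (use st in \<open>auto elim!: eventually_mono simp: step_def\<close>)
    show "F y \<le> F x - (s' - s) / b\<^sup>2"
    proof (rule tendsto_le[OF G])
      show "((\<lambda>h. F (u (A h)) - (S (B h) - S (A h)) / (B h)\<^sup>2) \<longlongrightarrow> F x - (s' - s) / b\<^sup>2) G"
        using A B stabA by (intro tendsto_intros) auto
      show "((\<lambda>h. F (u (B h))) \<longlongrightarrow> F y) G" by (rule stabB)
    qed (use st in \<open>auto elim!: eventually_mono simp: step_def\<close>)
  qed
  show "stable a x" "stable b y" by (fact stabA stabB)+
qed

lemma step_trans:
  assumes t: "0 < t" and 1: "step t s x t' s' x'" and 2: "step t' s' x' t'' s'' x''"
  shows "step t s x t'' s'' x''"
  unfolding step_def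
proof (intro conjI)
  have t': "t \<le> t'" "t' \<le> t''" "s \<le> s'" "s' \<le> s''" using 1 2 by (auto simp: step_def)
  then show "t \<le> t''" "s \<le> s''" by auto
  have "norm (x'' - x) \<le> norm (x'' - x') + norm (x' - x)"
    using norm_triangle_ineq[of "x'' - x'" "x' - x"] by simp
  also have "\<dots> \<le> (s'' - s') / t' + (s' - s) / t" using 1 2 by (intro add_mono) (auto simp: step_def)
  also have "(s'' - s') / t' \<le> (s'' - s') / t" using t t' by (intro divide_left_mono) auto
  finally show "norm (x'' - x) \<le> (s'' - s) / t" by (simp add: diff_divide_distrib)
  have "F x'' \<le> F x' - (s'' - s') / t''\<^sup>2" using 2 by (simp add: step_def)
  also have "F x' \<le> F x - (s' - s) / t'\<^sup>2" using 1 by (simp add: step_def)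
  finally have "F x'' \<le> F x - (s' - s) / t'\<^sup>2 - (s'' - s') / t''\<^sup>2" by simp
  moreover have "(s' - s) / t''\<^sup>2 \<le> (s' - s) / t'\<^sup>2"
    using t t' by (intro divide_left_mono power_mono) auto
  ultimately show "F x'' \<le> F x - (s'' - s) / t''\<^sup>2" by (simp add: diff_divide_distrib)
qed

lemma tendsto_left_limit:
  assumes t: "0 < t"
  shows "(S \<longlongrightarrow> left_limit S t) (at_left t)" "(u \<longlongrightarrow> left_limit u t) (at_left t)"
proof -
  have "(S \<longlongrightarrow> Sup (S ` ({..<t} \<inter> {0..}))) (at t within ({..<t} \<inter> {0..}))"
    by (rule Lim_left_bound[where K="S t"]) (auto intro!: S_mono)
  moreover have "at t within ({..<t} \<inter> {0..}) = at_left t"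
    by (rule at_within_nhd[of t "{0<..}"]) (use t in auto)
  ultimately have lim: "(S \<longlongrightarrow> Sup (S ` ({..<t} \<inter> {0..}))) (at_left t)" by simp
  then show S: "(S \<longlongrightarrow> left_limit S t) (at_left t)"
    using t tendsto_Lim[OF trivial_limit_at_left_real lim] by (simp add: left_limit_def)
  have "\<exists>x. (u \<longlongrightarrow> x) (at_left t)"
  proof (rule convergent_filter_of_Cauchy_bound[OF _ S])
    show "\<forall>\<^sub>F x in at_left t. x \<in> {t/2<..<t}" using t by (intro eventually_at_left_real) auto
    show "norm (u y - u x) \<le> (2 / t) * \<bar>S y - S x\<bar>" if "x \<in> {t/2<..<t}" "y \<in> {t/2<..<t}" "x < y" for x y
    proof -
      have x: "0 < x" "t / 2 < x" using that t by auto
      have "norm (u y - u x) \<le> (S y - S x) / x" using step_u[OF x(1) that(3)] by (simp add: step_def)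
      also have "\<dots> \<le> (S y - S x) / (t / 2)"
        using x t that S_mono[of x y] by (intro divide_left_mono) auto
      also have "\<dots> = (2 / t) * (S y - S x)" by simp
      also have "\<dots> \<le> (2 / t) * \<bar>S y - S x\<bar>" using t by (intro mult_left_mono) auto
      finally show ?thesis .
    qed
  qed (use t in auto)
  then obtain x where x: "(u \<longlongrightarrow> x) (at_left t)" by blast
  then show "(u \<longlongrightarrow> left_limit u t) (at_left t)"
    using t tendsto_Lim[OF trivial_limit_at_left_real x] by (simp add: left_limit_def)
qed

lemma tendsto_right_limit:
  assumes t: "0 < t"
  shows "(S \<longlongrightarrow> right_limit S t) (at_right t)" "(u \<longlongrightarrow> right_limit u t) (at_right t)"
proof -
  have "(S \<longlongrightarrow> Inf (S ` ({t<..} \<inter> UNIV))) (at t within ({t<..} \<inter> UNIV))"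
    by (rule Lim_right_bound[where K="S t"]) (use t in \<open>auto intro!: S_mono\<close>)
  then have lim: "(S \<longlongrightarrow> Inf (S ` {t<..})) (at_right t)" by simp
  then show S: "(S \<longlongrightarrow> right_limit S t) (at_right t)"
    using tendsto_Lim[OF trivial_limit_at_right_real lim] by (simp add: right_limit_def)
  have "\<exists>x. (u \<longlongrightarrow> x) (at_right t)"
  proof (rule convergent_filter_of_Cauchy_bound[OF _ S])
    show "\<forall>\<^sub>F x in at_right t. t < x" by (rule eventually_at_right_less)
    show "norm (u y - u x) \<le> (1 / t) * \<bar>S y - S x\<bar>" if "t < x" "t < y" "x < y" for x y
    proof -
      have x: "0 < x" using that t by auto
      have "norm (u y - u x) \<le> (S y - S x) / x" using step_u[OF x that(3)] by (simp add: step_def)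
      also have "\<dots> \<le> (S y - S x) / t"
        using x t that S_mono[of x y] by (intro divide_left_mono) auto
      also have "\<dots> = (1 / t) * (S y - S x)" by simp
      also have "\<dots> \<le> (1 / t) * \<bar>S y - S x\<bar>" using t by (intro mult_left_mono) auto
      finally show ?thesis .
    qed
  qed (use t in auto)
  then obtain x where x: "(u \<longlongrightarrow> x) (at_right t)" by blast
  then show "(u \<longlongrightarrow> right_limit u t) (at_right t)"
    using tendsto_Lim[OF trivial_limit_at_right_real x] by (simp add: right_limit_def)
qed

lemma left_limit_along:
  assumes t: "0 < t"
  shows "((\<lambda>h. S (t - h)) \<longlongrightarrow> left_limit S t) (at_right 0)" "((\<lambda>h. u (t - h)) \<longlongrightarrow> left_limit u t) (at_right 0)"
  using filterlim_compose[OF tendsto_left_limit(1)[OF t] filterlim_minus_at_left]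
    filterlim_compose[OF tendsto_left_limit(2)[OF t] filterlim_minus_at_left] by simp_all

lemma right_limit_along:
  assumes t: "0 < t"
  shows "((\<lambda>h. S (t + h)) \<longlongrightarrow> right_limit S t) (at_right 0)" "((\<lambda>h. u (t + h)) \<longlongrightarrow> right_limit u t) (at_right 0)"
  using filterlim_compose[OF tendsto_right_limit(1)[OF t] filterlim_plus_at_right]
    filterlim_compose[OF tendsto_right_limit(2)[OF t] filterlim_plus_at_right] by simp_all

lemma eventually_small: "0 < e \<Longrightarrow> \<forall>\<^sub>F h in at_right (0::real). 0 < h \<and> h < e"
  using eventually_at_right_real[of 0 e] by simp

lemma tendsto_minus_zero: "((\<lambda>h. t - h) \<longlongrightarrow> t) (at_right (0::real))"
  by (auto intro!: tendsto_eq_intros)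

lemma tendsto_plus_zero: "((\<lambda>h. t + h) \<longlongrightarrow> t) (at_right (0::real))"
  by (auto intro!: tendsto_eq_intros)

lemma step_jump:
  assumes t: "0 < t"
  shows "stable t (left_limit u t)" "stable t (right_limit u t)"
    "step t (left_limit S t) (left_limit u t) t (right_limit S t) (right_limit u t)"
proof -
  have ev: "\<forall>\<^sub>F h in at_right 0. 0 < t - h \<and> t - h < t + h"
    using eventually_small[OF t] by eventually_elim auto
  show "stable t (left_limit u t)" "stable t (right_limit u t)"
    "step t (left_limit S t) (left_limit u t) t (right_limit S t) (right_limit u t)"
    using step_limit[OF trivial_limit_at_right_real tendsto_minus_zero t left_limit_along[OF t]
      tendsto_plus_zero t right_limit_along[OF t] ev] by auto
qed

lemma step_between_jumps:
  assumes t: "0 < t" "t < t'"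
  shows "step t (right_limit S t) (right_limit u t) t' (left_limit S t') (left_limit u t')"
proof -
  have t': "0 < t'" using t by simp
  have "\<forall>\<^sub>F h in at_right 0. 0 < h \<and> h < (t' - t) / 2" using t by (intro eventually_small) auto
  then have ev: "\<forall>\<^sub>F h in at_right 0. 0 < t + h \<and> t + h < t' - h"
    by eventually_elim (use t in auto)
  show ?thesis
    using step_limit(3)[OF trivial_limit_at_right_real tendsto_plus_zero t(1) right_limit_along[OF t(1)]
      tendsto_minus_zero t' left_limit_along[OF t'] ev] .
qed

lemma step_to_jump:
  assumes t: "0 < r" "r < t"
  shows "step r (S r) (u r) t (left_limit S t) (left_limit u t)"
proof -
  have t': "0 < t" using t by simp
  have "\<forall>\<^sub>F h in at_right 0. 0 < h \<and> h < t - r" using t by (intro eventually_small) auto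
  then have ev: "\<forall>\<^sub>F h in at_right 0. 0 < r \<and> r < t - h"
    by eventually_elim (use t in auto)
  show ?thesis
    using step_limit(3)[OF trivial_limit_at_right_real tendsto_const t(1) tendsto_const tendsto_const
      tendsto_minus_zero t' left_limit_along[OF t'] ev] .
qed

lemma step_from_jump:
  assumes t: "0 < t" "t < r"
  shows "step t (right_limit S t) (right_limit u t) r (S r) (u r)"
proof -
  have r: "0 < r" using t by simp
  have "\<forall>\<^sub>F h in at_right 0. 0 < h \<and> h < r - t" using t by (intro eventually_small) auto
  then have ev: "\<forall>\<^sub>F h in at_right 0. 0 < t + h \<and> t + h < r"
    by eventually_elim (use t in auto)
  show ?thesis
    using step_limit(3)[OF trivial_limit_at_right_real tendsto_plus_zero t(1) right_limit_along[OF t(1)]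
      tendsto_const r tendsto_const tendsto_const ev] .
qed

lemma interpolate_0 [simp]: "interpolate g 0 t = left_limit g t"
  and interpolate_1 [simp]: "interpolate g 1 t = right_limit g t"
  by (simp_all add: interpolate_def)

text \<open>The step estimates across the jump give \<open>\<parallel>u(t+) - u(t-)\<parallel> \<le> t (F(u(t-)) - F(u(t+)))\<close>. Stability of
  \<open>u(t-)\<close> therefore bounds \<open>F v\<close> from below by the affine interpolation of the energies minus
  \<open>\<parallel>v - z\<parallel> / t\<close>, for every point \<open>z\<close> of the segment. With \<open>v = z\<close> and convexity, the energy is affine on
  the segment, and the bound is the stability of \<open>z\<close>.\<close>

lemma interpolate_along_jump:
  assumes t: "0 < t" and \<theta>: "\<theta> \<in> {0..1}"
  shows stable_interpolate: "stable t (interpolate u \<theta> t)"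
    and F_interpolate: "F (interpolate u \<theta> t) = (1 - \<theta>) * F (left_limit u t) + \<theta> * F (right_limit u t)"
proof -
  define x y where "x = left_limit u t" and "y = right_limit u t"
  define z where "z = interpolate u \<theta> t"
  note jump = step_jump[OF t, folded x_def y_def]
  have xy: "x \<in> D" "y \<in> D" using jump by (auto simp: stable_def)
  have z: "z = (1 - \<theta>) *\<^sub>R x + \<theta> *\<^sub>R y" by (simp add: z_def interpolate_def x_def y_def)
  have zD: "z \<in> D" and Fz: "F z \<le> (1 - \<theta>) * F x + \<theta> * F y" unfolding z using xy \<theta> by (auto intro: F_convex)
  define \<sigma> where "\<sigma> = right_limit S t - left_limit S t"
  have "norm (y - x) \<le> \<sigma> / t" and "F y \<le> F x - \<sigma> / t\<^sup>2"
    using jump(3) by (auto simp: step_def \<sigma>_def)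
  moreover have "\<sigma> / t\<^sup>2 = \<sigma> / t / t" by (simp add: power2_eq_square)
  ultimately have slope: "norm (y - x) / t \<le> F x - F y"
    using t divide_right_mono[of "norm (y - x)" "\<sigma> / t" t] by linarith
  have key: "(1 - \<theta>) * F x + \<theta> * F y \<le> F v + norm (v - z) / t" if v: "v \<in> D" for v
  proof -
    have "F x \<le> F v + norm (v - x) / t" using jump(1) v by (simp add: stable_def)
    moreover have "norm (v - x) / t \<le> (norm (v - z) + \<theta> * norm (y - x)) / t"
    proof (rule divide_right_mono)
      have "z - x = \<theta> *\<^sub>R (y - x)" by (simp add: z algebra_simps)
      then have "norm (z - x) = \<theta> * norm (y - x)" using \<theta> by simp
      then show "norm (v - x) \<le> norm (v - z) + \<theta> * norm (y - x)"
        using norm_triangle_ineq[of "v - z" "z - x"] by simp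
    qed (use t in simp)
    moreover have "\<theta> * (norm (y - x) / t) \<le> \<theta> * (F x - F y)"
      using slope \<theta> by (intro mult_left_mono) auto
    ultimately show ?thesis by (simp add: add_divide_distrib algebra_simps)
  qed
  show "stable t (interpolate u \<theta> t)"
    using Fz key zD unfolding stable_def z_def[symmetric] by force
  show "F (interpolate u \<theta> t) = (1 - \<theta>) * F (left_limit u t) + \<theta> * F (right_limit u t)"
    using Fz key[OF zD] unfolding z_def[symmetric] x_def[symmetric] y_def[symmetric] by simp
qed

lemma step_along_jump:
  assumes t: "0 < t" and \<theta>: "0 \<le> \<theta>" "\<theta> \<le> \<theta>'" "\<theta>' \<le> 1"
  shows "step t (interpolate S \<theta> t) (interpolate u \<theta> t) t (interpolate S \<theta>' t) (interpolate u \<theta>' t)"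
proof -
  let ?\<sigma> = "right_limit S t - left_limit S t"
  have jump: "left_limit S t \<le> right_limit S t" "norm (right_limit u t - left_limit u t) \<le> ?\<sigma> / t"
    "F (right_limit u t) \<le> F (left_limit u t) - ?\<sigma> / t\<^sup>2"
    using step_jump(3)[OF t] by (auto simp: step_def)
  have S: "interpolate S \<theta>' t - interpolate S \<theta> t = (\<theta>' - \<theta>) * ?\<sigma>"
    by (simp add: interpolate_def algebra_simps)
  have "interpolate u \<theta>' t - interpolate u \<theta> t = (\<theta>' - \<theta>) *\<^sub>R (right_limit u t - left_limit u t)"
    by (simp add: interpolate_def algebra_simps)
  then have "norm (interpolate u \<theta>' t - interpolate u \<theta> t) = (\<theta>' - \<theta>) * norm (right_limit u t - left_limit u t)"
    using \<theta> by simp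
  also have "\<dots> \<le> (\<theta>' - \<theta>) * (?\<sigma> / t)" using \<theta> jump by (intro mult_left_mono) auto
  finally have 1: "norm (interpolate u \<theta>' t - interpolate u \<theta> t) \<le> (interpolate S \<theta>' t - interpolate S \<theta> t) / t"
    by (simp add: S)
  have "(\<theta>' - \<theta>) * F (right_limit u t) \<le> (\<theta>' - \<theta>) * (F (left_limit u t) - ?\<sigma> / t\<^sup>2)"
    using \<theta> jump by (intro mult_left_mono) auto
  then have 2: "F (interpolate u \<theta>' t) \<le> F (interpolate u \<theta> t) - (interpolate S \<theta>' t - interpolate S \<theta> t) / t\<^sup>2"
    unfolding S using \<theta> by (simp add: F_interpolate[OF t] algebra_simps)
  have "0 \<le> (\<theta>' - \<theta>) * ?\<sigma>" using \<theta> jump by simp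
  with 1 2 show ?thesis by (simp add: step_def S[symmetric])
qed

lemma step_interpolate_trans:
  assumes t: "0 < t" "t < t'" and \<theta>: "\<theta> \<in> {0..1}" "\<theta>' \<in> {0..1}"
  shows "step t (interpolate S \<theta> t) (interpolate u \<theta> t) t' (interpolate S \<theta>' t') (interpolate u \<theta>' t')"
proof -
  have t': "0 < t'" using t by simp
  show ?thesis
    using step_trans[OF t(1) step_along_jump[of t \<theta> 1] step_trans[OF t(1) step_between_jumps[OF t, folded interpolate_0 interpolate_1]
      step_along_jump[of t' 0 \<theta>']]] t t' \<theta> by auto
qed

lemma step_u_interpolate:
  assumes t: "0 < r" "r < t" and \<theta>: "\<theta> \<in> {0..1}"
  shows "step r (S r) (u r) t (interpolate S \<theta> t) (interpolate u \<theta> t)"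
  using step_trans[OF t(1) step_to_jump[OF t, folded interpolate_0] step_along_jump[of t 0 \<theta>]] t \<theta> by auto

lemma step_interpolate_u:
  assumes t: "0 < t" "t < r" and \<theta>: "\<theta> \<in> {0..1}"
  shows "step t (interpolate S \<theta> t) (interpolate u \<theta> t) r (S r) (u r)"
  using step_trans[OF t(1) step_along_jump[of t \<theta> 1] step_from_jump[OF t, folded interpolate_1]] t \<theta> by auto

end

section \<open>The reparametrized function\<close>

context energetic
begin

lemma S_nonneg: "0 \<le> t \<Longrightarrow> 0 \<le> S t"
  using S_mono[of 0 t] by (simp add: S_0)

lemma S_tendsto_0: "(S \<longlongrightarrow> 0) (at_right 0)"
proof (rule tendsto_sandwich[of "\<lambda>_. 0" S "at_right 0" "\<lambda>t. t * I 0 1" 0])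
  show "((\<lambda>t. t * I 0 1) \<longlongrightarrow> 0) (at_right 0)" by (auto intro!: tendsto_eq_intros)
  have ev: "\<forall>\<^sub>F t in at_right (0::real). 0 < t \<and> t < 1" by (rule eventually_small) simp
  then show "\<forall>\<^sub>F t in at_right 0. 0 \<le> S t" by eventually_elim (auto intro: S_nonneg)
  from ev show "\<forall>\<^sub>F t in at_right 0. S t \<le> t * I 0 1" by eventually_elim (auto intro: S_small)
qed simp

lemma u_tendsto_0: "(u \<longlongrightarrow> u 0) (at_right 0)"
  using sol by (simp add: energetic_solution_def)

lemma interpolate_at_0: "interpolate S \<theta> 0 = 0" "interpolate u \<theta> 0 = u 0"
proof -
  have "right_limit S 0 = 0" "right_limit u 0 = u 0"
    unfolding right_limit_def
    using tendsto_Lim[OF trivial_limit_at_right_real S_tendsto_0]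
      tendsto_Lim[OF trivial_limit_at_right_real u_tendsto_0] by auto
  then show "interpolate S \<theta> 0 = 0" "interpolate u \<theta> 0 = u 0"
    by (simp_all add: interpolate_def left_limit_def S_0 flip: scaleR_add_left)
qed

lemma t_hat_nonneg: "0 \<le> t_hat u s"
  unfolding t_hat_def by (rule Inf_greatest) auto

lemma reparametrized_0: "reparametrized u 0 = u 0"
proof -
  have "t_hat u 0 \<le> 0"
    unfolding t_hat_def by (rule Inf_lower) (auto simp: S_0[unfolded S_def] image_iff zero_ereal_def)
  then have "t_hat u 0 = 0" using t_hat_nonneg by (rule antisym)
  then show ?thesis
    by (auto simp: reparametrized_def interpolate_at_0[unfolded S_def] intro!: the_equality bexI[of _ 0])
qed

lemma S_less_of_t_hat_infinite: "t_hat u s = \<infinity> \<Longrightarrow> 0 \<le> \<tau> \<Longrightarrow> S \<tau> < s"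
proof (rule ccontr)
  assume "t_hat u s = \<infinity>" "0 \<le> \<tau>" "\<not> S \<tau> < s"
  moreover from this have "t_hat u s \<le> ereal \<tau>"
    unfolding t_hat_def by (intro Inf_lower) (auto simp: S_def)
  ultimately show False by simp
qed

definition T :: "real \<Rightarrow> real" where "T s = real_of_ereal (t_hat u s)"

lemma t_hat_finite:
  assumes s: "0 < s" and fin: "t_hat u s \<noteq> \<infinity>"
  shows "0 < T s" "\<And>\<tau>. 0 \<le> \<tau> \<Longrightarrow> \<tau> < T s \<Longrightarrow> S \<tau> < s" "\<And>\<tau>. T s < \<tau> \<Longrightarrow> s \<le> S \<tau>"
proof -
  have T: "t_hat u s = ereal (T s)" using fin t_hat_nonneg[of s] by (cases "t_hat u s") (auto simp: T_def)
  then have T0: "0 \<le> T s" using t_hat_nonneg[of s] by simp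
  show less: "S \<tau> < s" if "0 \<le> \<tau>" "\<tau> < T s" for \<tau>
  proof (rule ccontr)
    assume "\<not> S \<tau> < s"
    then have "t_hat u s \<le> ereal \<tau>"
      unfolding t_hat_def using that by (intro Inf_lower) (auto simp: S_def)
    then show False using that T by simp
  qed
  show ge: "s \<le> S \<tau>" if "T s < \<tau>" for \<tau>
  proof -
    have "t_hat u s < ereal \<tau>" using that T by simp
    then obtain a where "0 \<le> a" "s \<le> S a" "a < \<tau>" unfolding t_hat_def S_def Inf_less_iff by auto
    then show ?thesis using S_mono[of a \<tau>] by simp
  qed
  show "0 < T s"
  proof (rule ccontr)
    assume "\<not> 0 < T s"
    then have "\<forall>\<^sub>F \<tau> in at_right 0. s \<le> S \<tau>"
      using ge eventually_small[of 1] by (auto elim!: eventually_mono)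
    then have "s \<le> 0" using S_tendsto_0 by (intro tendsto_lowerbound) auto
    then show False using s by simp
  qed
qed

lemma interpolation_unique:
  assumes t: "0 < t" and \<theta>: "\<theta> \<in> {0..1}" "\<theta>' \<in> {0..1}" and eq: "interpolate S \<theta> t = interpolate S \<theta>' t"
  shows "interpolate u \<theta> t = interpolate u \<theta>' t"
proof -
  have "step t (interpolate S \<theta> t) (interpolate u \<theta> t) t (interpolate S \<theta>' t) (interpolate u \<theta>' t) \<or>
      step t (interpolate S \<theta>' t) (interpolate u \<theta>' t) t (interpolate S \<theta> t) (interpolate u \<theta> t)"
    using step_along_jump[OF t, of \<theta> \<theta>'] step_along_jump[OF t, of \<theta>' \<theta>] \<theta>
    by (cases "\<theta> \<le> \<theta>'") auto
  then show ?thesis using eq by (auto simp: step_def)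
qed

text \<open>By definition of \<open>T s\<close> the value \<open>s\<close> lies in the (possibly degenerate) jump interval of \<open>S\<close> at the
  time \<open>T s\<close>, which provides \<open>\<theta>\<close>.\<close>

lemma reparametrized_finite:
  assumes s: "0 < s" and fin: "t_hat u s \<noteq> \<infinity>"
  obtains \<theta> where "\<theta> \<in> {0..1}" "s = interpolate S \<theta> (T s)" "reparametrized u s = interpolate u \<theta> (T s)"
proof -
  define t where "t = T s"
  note T = t_hat_finite[OF s fin, folded t_def]
  have left: "left_limit S t \<le> s"
  proof (rule tendsto_upperbound[OF tendsto_left_limit(1)[OF T(1)]])
    have "\<forall>\<^sub>F \<tau> in at_left t. \<tau> \<in> {0<..<t}" using T(1) by (rule eventually_at_left_real)
    then show "\<forall>\<^sub>F \<tau> in at_left t. S \<tau> \<le> s"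
      by eventually_elim (use T(2) in \<open>auto intro: less_imp_le\<close>)
  qed simp
  have right: "s \<le> right_limit S t"
  proof (rule tendsto_lowerbound[OF tendsto_right_limit(1)[OF T(1)]])
    show "\<forall>\<^sub>F \<tau> in at_right t. s \<le> S \<tau>"
      using eventually_at_right_less[of t] by eventually_elim (rule T(3))
  qed simp
  define \<sigma> where "\<sigma> = right_limit S t - left_limit S t"
  define \<theta> where "\<theta> = (if \<sigma> = 0 then 0 else (s - left_limit S t) / \<sigma>)"
  have \<theta>: "\<theta> \<in> {0..1}" using left right by (auto simp: \<theta>_def \<sigma>_def)
  have "interpolate S \<theta> t = left_limit S t + \<theta> * \<sigma>" by (simp add: interpolate_def \<sigma>_def algebra_simps)
  also have "\<dots> = s" using left right by (auto simp: \<theta>_def \<sigma>_def)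
  finally have eq: "s = interpolate S \<theta> t" by simp
  have "(THE x. \<exists>\<theta>\<in>{0..1}. s = interpolate S \<theta> t \<and> x = interpolate u \<theta> t) = interpolate u \<theta> t"
  proof (rule the_equality)
    show "\<exists>\<theta>'\<in>{0..1}. s = interpolate S \<theta>' t \<and> interpolate u \<theta> t = interpolate u \<theta>' t" using \<theta> eq by blast
    show "x = interpolate u \<theta> t" if "\<exists>\<theta>\<in>{0..1}. s = interpolate S \<theta> t \<and> x = interpolate u \<theta> t" for x
      using that \<theta> eq interpolation_unique[OF T(1)] by metis
  qed
  then have "reparametrized u s = interpolate u \<theta> t"
    using fin by (simp add: reparametrized_def Let_def t_def T_def S_def)
  from that[OF \<theta> eq[unfolded t_def] this[unfolded t_def]] show thesis .
qed

text \<open>Testing the stability of \<open>u(t)\<close> with \<open>u(t)/2\<close> shows that the energy vanishes as \<open>t \<rightarrow> \<infinity>\<close> if \<open>u\<close>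
  converges.\<close>

lemma F_u_le: "0 < t \<Longrightarrow> F (u t) \<le> norm (u t) / t"
proof -
  assume t: "0 < t"
  have "J ((1/2) *\<^sub>R u t) = ennreal (1/2) * J (u t)"
    using J_homogeneous unfolding positively_homogeneous_def by (metis half_gt_zero zero_less_one)
  also have "\<dots> = ennreal ((1/2) * F (u t))"
    by (simp only: J_eq[OF u_in_D[OF t]] ennreal_mult[OF _ F_nonneg])
  finally have J: "J ((1/2) *\<^sub>R u t) = ennreal ((1/2) * F (u t))" .
  then have D: "(1/2) *\<^sub>R u t \<in> D" by (simp add: in_D_iff)
  have "F ((1/2) *\<^sub>R u t) = F (u t) / 2" unfolding F_def[of "_ *\<^sub>R _"] J using F_nonneg by simp
  moreover have "F (u t) \<le> F ((1/2) *\<^sub>R u t) + norm ((1/2) *\<^sub>R u t - u t) / t"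
    using stable_u[OF t] D by (auto simp: stable_def)
  moreover have "(1/2) *\<^sub>R u t - u t = - ((1/2) *\<^sub>R u t)" by (simp add: algebra_simps flip: scaleR_add_left)
  then have "norm ((1/2) *\<^sub>R u t - u t) = norm (u t) / 2" by simp
  ultimately show ?thesis by (simp add: field_simps)
qed

text \<open>If \<open>S\<close> is bounded then so is the variation of \<open>u\<close> on \<open>[1,\<infinity>)\<close>. The limit of \<open>u\<close> minimizes the energy,
  so that \<open>W\<close> may rest there for all later parameters.\<close>

lemma limit_at_infinity:
  assumes bound: "\<And>\<tau>. 0 \<le> \<tau> \<Longrightarrow> S \<tau> < s"
  shows "(u \<longlongrightarrow> Lim at_top u) at_top" "Lim at_top u \<in> D" "F (Lim at_top u) = 0"
proof -
  define l where "l = Sup (S ` {0..})"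
  have bdd: "bdd_above (S ` {0..})" using bound by (intro bdd_aboveI2[of _ _ s]) (auto intro: less_imp_le)
  have S: "(S \<longlongrightarrow> l) at_top"
  proof (rule order_tendstoI)
    fix a assume "a < l"
    then obtain \<tau> where \<tau>: "0 \<le> \<tau>" "a < S \<tau>" using bdd unfolding l_def by (subst (asm) less_cSup_iff) auto
    show "\<forall>\<^sub>F x in at_top. a < S x"
      using eventually_ge_at_top[of \<tau>] by eventually_elim (use \<tau> S_mono[of \<tau>] in force)
  next
    fix a assume "l < a"
    moreover have "S x \<le> l" if "0 \<le> x" for x unfolding l_def using bdd that by (intro cSup_upper) auto
    ultimately have "S x < a" if "0 \<le> x" for x using that by (meson le_less_trans)
    then show "\<forall>\<^sub>F x in at_top. S x < a"
      by (rule eventually_mono[OF eventually_ge_at_top[of "0::real"]])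
  qed
  have "\<exists>x. (u \<longlongrightarrow> x) at_top"
  proof (rule convergent_filter_of_Cauchy_bound[OF _ S])
    show "\<forall>\<^sub>F x in at_top. (1::real) \<le> x" by (rule eventually_ge_at_top)
    show "norm (u y - u x) \<le> 1 * \<bar>S y - S x\<bar>" if "1 \<le> x" "1 \<le> y" "x < y" for x y
    proof -
      have "norm (u y - u x) \<le> (S y - S x) / x" using step_u[of x y] that by (simp add: step_def)
      also have "\<dots> \<le> (S y - S x) / 1"
        using that S_mono[of x y] by (intro divide_left_mono) auto
      finally show ?thesis by simp
    qed
  qed auto
  then obtain x where x: "(u \<longlongrightarrow> x) at_top" by blast
  have "((\<lambda>t. norm (u t) / t) \<longlongrightarrow> 0) at_top"
    by (rule tendsto_divide_0[OF tendsto_norm[OF x]]) (simp add: filterlim_at_top_imp_at_infinity filterlim_ident)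
  moreover have "\<forall>\<^sub>F t in at_top. u t \<in> D \<and> F (u t) \<le> norm (u t) / t"
    using eventually_gt_at_top[of "0::real"] by eventually_elim (use F_u_le u_in_D in auto)
  ultimately have "x \<in> D" "F x \<le> 0" using F_lsc_limit[OF _ x] by auto
  moreover have "Lim at_top u = x" using x by (intro tendsto_Lim) auto
  ultimately show "(u \<longlongrightarrow> Lim at_top u) at_top" "Lim at_top u \<in> D" "F (Lim at_top u) = 0"
    using x F_nonneg[of x] by auto
qed

abbreviation W :: "real \<Rightarrow> 'a" where "W \<equiv> reparametrized u"

text \<open>Where \<open>t\<close>-hat is infinite, \<open>W\<close> rests at a minimizer and both its speed and the slope vanish.\<close>

definition rho :: "real \<Rightarrow> real" where
  "rho s = (if t_hat u s = \<infinity> then 0 else 1 / T s)"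

lemma rho_nonneg: "0 < s \<Longrightarrow> 0 \<le> rho s"
  using t_hat_finite(1)[of s] by (auto simp: rho_def intro: less_imp_le)

lemma reparametrized_infinite: "t_hat u s = \<infinity> \<Longrightarrow> W s = Lim at_top u"
  by (simp add: reparametrized_def)

lemma limit_at_infinity_t_hat:
  assumes "t_hat u s = \<infinity>"
  shows "(u \<longlongrightarrow> W s) at_top" "W s \<in> D" "F (W s) = 0"
  unfolding reparametrized_infinite[OF assms]
  by (rule limit_at_infinity[OF S_less_of_t_hat_infinite[OF assms]], assumption)+

lemma t_hat_mono: "s \<le> s' \<Longrightarrow> t_hat u s \<le> t_hat u s'"
  unfolding t_hat_def by (intro Inf_superset_mono) auto

lemma stable_W:
  assumes "0 < s" "t_hat u s \<noteq> \<infinity>"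
  shows "stable (T s) (W s)"
  using reparametrized_finite[OF assms] stable_interpolate[OF t_hat_finite(1)[OF assms]] by metis

lemma W_in_D: "0 < s \<Longrightarrow> W s \<in> D"
  using stable_W[of s] limit_at_infinity_t_hat[of s] by (auto simp: stable_def)

lemma slope_W: "0 < s \<Longrightarrow> v \<in> D \<Longrightarrow> F (W s) \<le> F v + rho s * norm (v - W s)"
  using stable_W[of s] limit_at_infinity_t_hat(3)[of s] F_nonneg by (auto simp: rho_def stable_def)

lemma step_W:
  assumes s: "0 < s" "s < s'" and fin: "t_hat u s' \<noteq> \<infinity>"
  shows "step (T s) s (W s) (T s') s' (W s')"
proof -
  have fin': "t_hat u s \<noteq> \<infinity>" using t_hat_mono[of s s'] s fin by auto
  have s': "0 < s'" using s by simp
  have T: "0 < T s" "0 < T s'" using t_hat_finite(1) s s' fin fin' by auto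
  have "T s \<le> T s'"
    using t_hat_mono[of s s'] t_hat_nonneg[of s] s fin fin' unfolding T_def
    by (intro real_of_ereal_positive_mono) auto
  obtain \<theta> where \<theta>: "\<theta> \<in> {0..1}" "s = interpolate S \<theta> (T s)" "W s = interpolate u \<theta> (T s)"
    using reparametrized_finite[OF s(1) fin'] .
  obtain \<theta>' where \<theta>': "\<theta>' \<in> {0..1}" "s' = interpolate S \<theta>' (T s')" "W s' = interpolate u \<theta>' (T s')"
    using reparametrized_finite[OF s' fin] .
  have "step (T s) (interpolate S \<theta> (T s)) (interpolate u \<theta> (T s)) (T s') (interpolate S \<theta>' (T s')) (interpolate u \<theta>' (T s'))"
  proof (cases "T s = T s'")
    case True
    have "\<theta> \<le> \<theta>'"
    proof (rule ccontr)
      assume "\<not> \<theta> \<le> \<theta>'"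
      then have "interpolate S \<theta>' (T s') \<le> interpolate S \<theta> (T s)"
        using step_along_jump[OF T(1), of \<theta>' \<theta>] \<theta>(1) \<theta>'(1) by (auto simp: step_def True)
      then show False using s(2) \<theta>(2) \<theta>'(2) by linarith
    qed
    then show ?thesis using step_along_jump[OF T(1), of \<theta> \<theta>'] \<theta>(1) \<theta>'(1) by (simp add: True)
  next
    case False
    then show ?thesis using \<open>T s \<le> T s'\<close> T \<theta>(1) \<theta>'(1) by (intro step_interpolate_trans) auto
  qed
  then show ?thesis by (simp only: \<theta>(2,3)[symmetric] \<theta>'(2,3)[symmetric])
qed

lemma speed_W:
  assumes s: "0 < s" "s < s'"
  shows "norm (W s' - W s) \<le> rho s * (s' - s)"
proof (cases "t_hat u s' = \<infinity>")
  case False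
  then have "t_hat u s \<noteq> \<infinity>" using t_hat_mono[of s s'] s by auto
  then show ?thesis using step_W[OF s False] by (simp add: step_def rho_def)
next
  case inf: True
  show ?thesis
  proof (cases "t_hat u s = \<infinity>")
    case True
    then show ?thesis using inf by (simp add: rho_def reparametrized_infinite)
  next
    case False
    obtain \<theta> where \<theta>: "\<theta> \<in> {0..1}" "s = interpolate S \<theta> (T s)" "W s = interpolate u \<theta> (T s)"
      using reparametrized_finite[OF s(1) False] .
    have T: "0 < T s" using t_hat_finite(1)[OF s(1) False] .
    have "norm (W s' - W s) \<le> (s' - s) / T s"
    proof (rule tendsto_upperbound)
      show "((\<lambda>\<tau>. norm (u \<tau> - W s)) \<longlongrightarrow> norm (W s' - W s)) at_top"
        by (intro tendsto_intros limit_at_infinity_t_hat(1)[OF inf])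
      show "\<forall>\<^sub>F \<tau> in at_top. norm (u \<tau> - W s) \<le> (s' - s) / T s"
        using eventually_gt_at_top[of "T s"]
      proof eventually_elim
        case (elim \<tau>)
        have "norm (u \<tau> - W s) \<le> (S \<tau> - s) / T s"
          using step_interpolate_u[OF T elim \<theta>(1)] by (simp add: step_def \<theta>(2,3)[symmetric])
        also have "\<dots> \<le> (s' - s) / T s"
          using S_less_of_t_hat_infinite[OF inf, of \<tau>] T elim by (intro divide_right_mono) auto
        finally show ?case .
      qed
    qed simp
    then show ?thesis using False by (simp add: rho_def)
  qed
qed

lemma descent_W:
  assumes s: "0 < s" "s < s'"
  shows "F (W s') \<le> F (W s) - (rho s')\<^sup>2 * (s' - s)"
proof (cases "t_hat u s' = \<infinity>")
  case False
  then show ?thesis using step_W[OF s False] by (simp add: step_def rho_def power_divide)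
next
  case True
  then show ?thesis using limit_at_infinity_t_hat(3)[OF True] F_nonneg[of "W s"] by (simp add: rho_def)
qed

lemma rho_antimono:
  assumes "0 < s" "s \<le> s'"
  shows "rho s' \<le> rho s"
proof (cases "s = s' \<or> t_hat u s' = \<infinity>")
  case True
  then show ?thesis using rho_nonneg[of s] assms by (auto simp: rho_def)
next
  case False
  then have "t_hat u s \<noteq> \<infinity>" using t_hat_mono[of s s'] assms by auto
  moreover have "T s \<le> T s'" using step_W[of s s'] False assms by (simp add: step_def)
  ultimately show ?thesis
    using False t_hat_finite(1)[of s] assms by (auto simp: rho_def intro!: divide_left_mono)
qed

sublocale curve: maximal_slope_curve F D W rho
  by unfold_locales
     (fact F_convex W_in_D speed_W descent_W slope_W rho_nonneg rho_antimono)+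

text \<open>A step from the state of \<open>u\<close> at the fixed time \<open>r\<close>. This replaces the Lipschitz bound, which degenerates
  as \<open>s \<rightarrow> 0\<close>.\<close>

lemma W_near_u:
  assumes s: "0 < s" and r: "0 < r" "t_hat u s = \<infinity> \<or> r < T s"
  shows "norm (W s - u r) \<le> s / r"
proof (cases "t_hat u s = \<infinity>")
  case True
  show ?thesis
  proof (rule tendsto_upperbound)
    show "((\<lambda>\<tau>. norm (u \<tau> - u r)) \<longlongrightarrow> norm (W s - u r)) at_top"
      by (intro tendsto_intros limit_at_infinity_t_hat(1)[OF True])
    show "\<forall>\<^sub>F \<tau> in at_top. norm (u \<tau> - u r) \<le> s / r"
      using eventually_gt_at_top[of r]
    proof eventually_elim
      case (elim \<tau>)
      have "norm (u \<tau> - u r) \<le> (S \<tau> - S r) / r" using step_u[OF r(1) elim] by (simp add: step_def)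
      also have "\<dots> \<le> s / r"
        using S_less_of_t_hat_infinite[OF True, of \<tau>] S_nonneg[of r] r elim by (intro divide_right_mono) auto
      finally show ?case .
    qed
  qed simp
next
  case False
  obtain \<theta> where \<theta>: "\<theta> \<in> {0..1}" "s = interpolate S \<theta> (T s)" "W s = interpolate u \<theta> (T s)"
    using reparametrized_finite[OF s False] .
  have "norm (W s - u r) \<le> (s - S r) / r"
    using step_u_interpolate[OF r(1) _ \<theta>(1), of "T s"] r False by (simp add: step_def \<theta>(2,3)[symmetric])
  also have "\<dots> \<le> s / r" using S_nonneg[of r] r by (intro divide_right_mono) auto
  finally show ?thesis .
qed

text \<open>Choose \<open>r\<close> such that \<open>u\<close> is close to \<open>u 0\<close> on \<open>(0,2r)\<close>. If \<open>T s \<le> r\<close>, then \<open>W s\<close> is a convex combination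
  of limits of \<open>u\<close> in this interval; otherwise \<open>W s\<close> is close to \<open>u r\<close> for small \<open>s\<close>. Both cases occur,
  since \<open>T s\<close> does not tend to \<open>0\<close> if \<open>u\<close> is constant near \<open>0\<close>.\<close>

lemma W_tendsto_0: "(W \<longlongrightarrow> u 0) (at_right 0)"
proof (rule tendstoI)
  fix e :: real assume e: "0 < e"
  have "\<forall>\<^sub>F \<tau> in at_right 0. dist (u \<tau>) (u 0) < e / 2" using u_tendsto_0 e by (intro tendstoD) auto
  then obtain b where b: "0 < b" "\<And>\<tau>. 0 < \<tau> \<Longrightarrow> \<tau> < b \<Longrightarrow> dist (u \<tau>) (u 0) < e / 2"
    by (auto simp: eventually_at_right_field)
  define r where "r = b / 2"
  have r: "0 < r" "r < b" using b by (auto simp: r_def)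
  have "0 < e / 2 * r" using e r by simp
  then have "\<forall>\<^sub>F s in at_right 0. 0 < s \<and> s < e / 2 * r" by (rule eventually_small)
  then show "\<forall>\<^sub>F s in at_right 0. dist (W s) (u 0) < e"
  proof eventually_elim
    case (elim s)
    show ?case
    proof (cases "t_hat u s = \<infinity> \<or> r < T s")
      case True
      have "dist (W s) (u 0) \<le> dist (W s) (u r) + dist (u r) (u 0)" by (rule dist_triangle)
      also have "dist (W s) (u r) \<le> s / r" unfolding dist_norm using elim r True by (intro W_near_u) auto
      also have "s / r < e / 2" using elim r by (simp add: field_simps)
      also have "dist (u r) (u 0) < e / 2" using b r by auto
      finally show ?thesis by simp
    next
      case False
      then obtain \<theta> where \<theta>: "\<theta> \<in> {0..1}" "W s = interpolate u \<theta> (T s)"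
        using reparametrized_finite[of s] elim by metis
      have T: "0 < T s" "T s < b" using t_hat_finite(1)[of s] False elim r by auto
      have "left_limit u (T s) \<in> cball (u 0) (e / 2)"
      proof (rule Lim_in_closed_set[OF closed_cball _ _ tendsto_left_limit(2)[OF T(1)]])
        have "\<forall>\<^sub>F \<tau> in at_left (T s). \<tau> \<in> {0<..<T s}" using T(1) by (rule eventually_at_left_real)
        then show "\<forall>\<^sub>F \<tau> in at_left (T s). u \<tau> \<in> cball (u 0) (e / 2)"
          by eventually_elim (use b(2) T in \<open>auto simp: dist_commute intro: less_imp_le\<close>)
      qed simp
      moreover have "right_limit u (T s) \<in> cball (u 0) (e / 2)"
      proof (rule Lim_in_closed_set[OF closed_cball _ _ tendsto_right_limit(2)[OF T(1)]])
        have "\<forall>\<^sub>F \<tau> in at_right (T s). \<tau> \<in> {T s<..<b}" using T(2) by (rule eventually_at_right_real)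
        then show "\<forall>\<^sub>F \<tau> in at_right (T s). u \<tau> \<in> cball (u 0) (e / 2)"
          by eventually_elim (use b(2) T in \<open>auto simp: dist_commute intro: less_imp_le\<close>)
      qed simp
      ultimately have "W s \<in> cball (u 0) (e / 2)"
        unfolding \<theta>(2) interpolate_def using \<theta>(1) by (intro convexD_alt[OF convex_cball]) auto
      then show ?thesis using e by (simp add: dist_commute)
    qed
  qed
qed

lemma continuous_on_W: "continuous_on {0..} W"
  unfolding continuous_on_eq_continuous_within
proof
  fix s :: real assume "s \<in> {0..}"
  then consider "s = 0" | "0 < s" by force
  then show "continuous (at s within {0..}) W"
  proof cases
    case 1
    have "at 0 within {0..} = at_right (0::real)"
      by (rule at_within_nhd[of _ UNIV]) auto
    then show ?thesis using W_tendsto_0 by (simp add: 1 continuous_within reparametrized_0)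
  next
    case 2
    then show ?thesis using curve.continuous_on_pos
      by (auto simp: continuous_on_eq_continuous_at intro: continuous_at_imp_continuous_at_within)
  qed
qed

lemma inclusion_W:
  assumes s: "0 < s" and cont: "isCont rho s"
  shows "W differentiable (at s) \<and> 0 \<in> riesz (vector_derivative W (at s)) +o subdifferential J (W s)"
proof -
  obtain d where d: "(W has_vector_derivative d) (at s)" "norm d \<le> rho s"
    using curve.has_derivative_at_continuity_point[OF s cont] .
  have D: "W s \<in> D" by (rule W_in_D[OF s])
  have "riesz (- d) \<in> subdifferential J (W s)"
    unfolding subdifferential_def
  proof (intro CollectI conjI allI)
    show "W s \<in> effective_domain J" using D by (simp add: D_def)
    fix v show "enn2ereal (J (W s)) + ereal (blinfun_apply (riesz (- d)) (v - W s)) \<le> enn2ereal (J v)"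
    proof (cases "v \<in> D")
      case True
      then show ?thesis using curve.subgradient_at_continuity_point[OF s cont True d] D
        by (simp add: J_eq F_nonneg enn2ereal_ennreal)
    next
      case False
      then have "J v = \<infinity>" using top.not_eq_extremum[of "J v"] by (auto simp: in_D_iff)
      then show ?thesis by simp
    qed
  qed
  then have "riesz d + riesz (- d) \<in> riesz d +o subdifferential J (W s)" by (rule set_plus_intro2)
  moreover have "riesz d + riesz (- d) = 0" by (rule blinfun_eqI) (simp add: blinfun.bilinear_simps)
  ultimately have "0 \<in> riesz d +o subdifferential J (W s)" by simp
  then show ?thesis using d(1) by (auto simp: vector_derivative_at intro: differentiableI_vector)
qed

lemma gradient_solution_W: "gradient_solution J W"
  unfolding gradient_solution_def
proof (intro conjI continuous_on_W curve.H1_loc)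
  have "AE s in lebesgue. s \<notin> {s \<in> {0<..}. \<not> isCont rho s}"
    by (intro AE_not_in null_sets_completionI countable_imp_null_set_lborel curve.countable_discontinuities)
  then show "AE s in lebesgue_on {0<..}. W differentiable (at s) \<and>
      0 \<in> riesz (vector_derivative W (at s)) +o subdifferential J (W s)"
    by (subst AE_restrict_space_iff) (auto elim!: eventually_mono dest: inclusion_W)
qed

end

theorem theorem6p1:
  fixes J :: "'a::{real_inner, complete_space} \<Rightarrow> ennreal"
    and u :: "real \<Rightarrow> 'a"
  assumes "convex_functional J"
    and "lower_semicontinuous J"
    and "positively_homogeneous J"
    and "closure (effective_domain J) = UNIV"
    and "energetic_solution J u"
  shows "gradient_solution J (reparametrized u) \<and> reparametrized u 0 = u 0"
proof -
  interpret energetic J u by unfold_locales (fact assms)+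
  show ?thesis using gradient_solution_W reparametrized_0 by blast
qed

end
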